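(* Let $r\ge 2$ and let $G$ be a complete $r$-partite graph $K_{n_1,\dots,n_r}$ with $n_1,\dots,n_r\geq 1$ and $n=\sum_{j=1}^r n_j$ vertices. Let $\mathbb{K}$ be a field and $S=\mathbb{K}[x_{ij}: i\in\{1,2\},\, j\in\{1,\dots,n\}]$. Then the binomial edge ideal $J_G\subset S$ is of König type.
   Context: A complete $r$-partite graph $K_{n_1,\dots,n_r}$ has vertex set partitioned into $r$ parts of sizes $n_1,\dots,n_r$, with two vertices adjacent if and only if they lie in different parts; its vertices are labelled by $\{1,\dots,n\}$, with the parts being consecutive intervals of integers: the $k$-th part is $\{1+\sum_{j=1}^{k-1}n_j,\dots,\sum_{j=1}^{k}n_j\}$. (If all $n_i=1$ it is the complete graph $K_r$.) The binomial edge ideal of a finite simple graph $G$ on $\{1,\dots,n\}$ is $J_G=(x_{1k}x_{2l}-x_{1l}x_{2k}: \{k,l\}\in E(G),\ k<l)\subset S$. A graded ideal $I$ of height $h$ in a standard graded polynomial ring $S$ over a field is said to be of König type if there exist homogeneous polynomials $f_1,\dots,f_h$ forming part of a minimal system of homogeneous generators of $I$ and a monomial order $<$ on $S$ such that the initial monomials $\operatorname{in}_<(f_1),\dots,\operatorname{in}_<(f_h)$ form a regular sequence in $S$. *)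

theory Defs
  imports
    "HOL-Algebra.QuotRing"
    "HOL-Library.Poly_Mapping"
    "HOL-Library.Extended_Nat"
begin

section \<open>Height and regular sequences in commutative rings\<close>

text \<open>The height of a prime is the supremum of the lengths \<open>m\<close> of strict chains
  \<open>Q 0 \<subset> \<dots> \<subset> Q m = P\<close> of primes; the height of an ideal is the infimum of the heights
  of the primes containing it (so the unit ideal has height \<open>\<infinity>\<close>).\<close>

definition prime_height :: "('a, 'm) ring_scheme \<Rightarrow> 'a set \<Rightarrow> enat" where
  "prime_height R P =
     Sup {enat m | m. \<exists>Q :: nat \<Rightarrow> 'a set.
        (\<forall>i\<le>m. primeideal (Q i) R) \<and> (\<forall>i<m. Q i \<subset> Q (Suc i)) \<and> Q m = P}"

definition ideal_height :: "('a, 'm) ring_scheme \<Rightarrow> 'a set \<Rightarrow> enat" where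
  "ideal_height R I = Inf {prime_height R P | P. primeideal P R \<and> I \<subseteq> P}"

text \<open>The first condition says that \<open>fs ! i\<close> is a nonzerodivisor on \<open>R\<close> modulo the ideal
  generated by its predecessors; the second that \<open>R\<close> modulo the whole sequence is nonzero.\<close>

definition regular_sequence :: "('a, 'm) ring_scheme \<Rightarrow> 'a list \<Rightarrow> bool" where
  "regular_sequence R fs \<longleftrightarrow>
     set fs \<subseteq> carrier R \<and>
     (\<forall>i<length fs. \<forall>g\<in>carrier R.
        (fs ! i) \<otimes>\<^bsub>R\<^esub> g \<in> genideal R (set (take i fs)) \<longrightarrow>
        g \<in> genideal R (set (take i fs))) \<and>
     genideal R (set fs) \<noteq> carrier R"


section \<open>Polynomial rings in a given set of variables\<close>

text \<open>A monomial is identified with its exponent vector.\<close>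

type_synonym 'x mon = "'x \<Rightarrow>\<^sub>0 nat"
type_synonym ('x, 'k) mpol = "'x mon \<Rightarrow>\<^sub>0 'k"

definition monomials :: "'x set \<Rightarrow> 'x mon set" where
  "monomials X = {m. Poly_Mapping.keys m \<subseteq> X}"

definition poly_ring :: "'x set \<Rightarrow> ('x, 'k::field) mpol ring" where
  "poly_ring X =
     \<lparr>carrier = {p. Poly_Mapping.keys p \<subseteq> monomials X},
      mult = (*), one = 1, zero = 0, add = (+)\<rparr>"

definition var :: "'x \<Rightarrow> ('x, 'k::field) mpol" where
  "var x = Poly_Mapping.single (Poly_Mapping.single x 1) 1"

definition mon_degree :: "'x mon \<Rightarrow> nat" where
  "mon_degree m = (\<Sum>x\<in>Poly_Mapping.keys m. Poly_Mapping.lookup m x)"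

definition homogeneous :: "('x, 'k::field) mpol \<Rightarrow> bool" where
  "homogeneous p \<longleftrightarrow> (\<exists>d. \<forall>m\<in>Poly_Mapping.keys p. mon_degree m = d)"

text \<open>Orders are reflexive relations: \<open>(m, m') \<in> r\<close> means \<open>m \<le> m'\<close>. Multiplication of
  monomials is addition of exponent vectors, and the monomial \<open>1\<close> is \<open>0\<close>.\<close>

definition monomial_order :: "'x set \<Rightarrow> 'x mon rel \<Rightarrow> bool" where
  "monomial_order X r \<longleftrightarrow>
     linear_order_on (monomials X) r \<and>
     (\<forall>m\<in>monomials X. (0, m) \<in> r) \<and>
     (\<forall>m m' u. (m, m') \<in> r \<and> u \<in> monomials X \<longrightarrow> (m + u, m' + u) \<in> r)"

text \<open>The initial monomial, as a polynomial with coefficient 1; only meaningful for \<open>f \<noteq> 0\<close>.\<close>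

definition initial_monomial :: "'x mon rel \<Rightarrow> ('x, 'k::field) mpol \<Rightarrow> ('x, 'k) mpol" where
  "initial_monomial r f =
     Poly_Mapping.single
       (THE m. m \<in> Poly_Mapping.keys f \<and> (\<forall>m'\<in>Poly_Mapping.keys f. (m', m) \<in> r)) 1"

definition minimal_homogeneous_generators ::
    "'x set \<Rightarrow> ('x, 'k::field) mpol set \<Rightarrow> ('x, 'k) mpol set \<Rightarrow> bool" where
  "minimal_homogeneous_generators X I F \<longleftrightarrow>
     F \<subseteq> carrier (poly_ring X) \<and> (\<forall>f\<in>F. homogeneous f) \<and>
     genideal (poly_ring X) F = I \<and>
     (\<forall>G. G \<subset> F \<longrightarrow> genideal (poly_ring X) G \<noteq> I)"

text \<open>That \<open>I\<close> is a graded ideal is implied by the existence of homogeneous generators.\<close>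

definition koenig_type :: "'x set \<Rightarrow> ('x, 'k::field) mpol set \<Rightarrow> bool" where
  "koenig_type X I \<longleftrightarrow>
     (\<exists>h F fs r.
        ideal_height (poly_ring X :: ('x, 'k) mpol ring) I = enat h \<and>
        minimal_homogeneous_generators X I F \<and>
        length fs = h \<and> distinct fs \<and> set fs \<subseteq> F \<and>
        monomial_order X r \<and>
        regular_sequence (poly_ring X) (map (initial_monomial r) fs))"


section \<open>Binomial edge ideals\<close>

text \<open>A graph on \<open>{1..n}\<close> is given by its set of edges, each edge a two-element set of vertices.
  The variable \<open>x\<^sub>i\<^sub>j\<close> is indexed by the pair \<open>(i, j)\<close>.\<close>

definition bei_vars :: "nat \<Rightarrow> (nat \<times> nat) set" where
  "bei_vars n = {1, 2} \<times> {1..n}"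

definition binomial_edge_ideal :: "nat \<Rightarrow> nat set set \<Rightarrow> (nat \<times> nat, 'k::field) mpol set" where
  "binomial_edge_ideal n E =
     genideal (poly_ring (bei_vars n))
       {var (1, k) * var (2, l) - var (1, l) * var (2, k) | k l. {k, l} \<in> E \<and> k < l}"

definition part :: "(nat \<Rightarrow> nat) \<Rightarrow> nat \<Rightarrow> nat set" where
  "part ns k = {1 + (\<Sum>j=1..<k. ns j) .. (\<Sum>j=1..k. ns j)}"

definition complete_multipartite_edges :: "nat \<Rightarrow> (nat \<Rightarrow> nat) \<Rightarrow> nat set set" where
  "complete_multipartite_edges r ns =
     {{u, v} | u v. \<exists>a\<in>{1..r}. \<exists>b\<in>{1..r}. a \<noteq> b \<and> u \<in> part ns a \<and> v \<in> part ns b}"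


section \<open>Basic facts\<close>

lemma monomials_add: "m \<in> monomials X \<Longrightarrow> m' \<in> monomials X \<Longrightarrow> m + m' \<in> monomials X"
  using Poly_Mapping.keys_add[of m m'] by (auto simp: monomials_def)

lemma cring_poly_ring: "cring (poly_ring X :: ('x, 'k::field) mpol ring)"
proof (rule cringI)
  let ?R = "poly_ring X :: ('x, 'k) mpol ring"
  show "abelian_group ?R"
  proof (rule abelian_groupI)
    fix p q assume "p \<in> carrier ?R" "q \<in> carrier ?R"
    then show "p \<oplus>\<^bsub>?R\<^esub> q \<in> carrier ?R"
      using Poly_Mapping.keys_add[of p q] by (auto simp: poly_ring_def)
  next
    fix p assume "p \<in> carrier ?R"
    then show "\<exists>q\<in>carrier ?R. q \<oplus>\<^bsub>?R\<^esub> p = \<zero>\<^bsub>?R\<^esub>"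
      by (intro bexI[of _ "- p"]) (auto simp: poly_ring_def in_keys_iff)
  qed (auto simp: poly_ring_def algebra_simps)
  show "comm_monoid ?R"
  proof (rule comm_monoidI)
    fix p q assume "p \<in> carrier ?R" "q \<in> carrier ?R"
    then show "p \<otimes>\<^bsub>?R\<^esub> q \<in> carrier ?R"
      using Poly_Mapping.keys_mult[of p q] monomials_add[of _ X] by (fastforce simp: poly_ring_def)
  qed (auto simp: poly_ring_def algebra_simps monomials_def)
qed (auto simp: poly_ring_def algebra_simps)

end

theory Submission
  imports Defs "HOL-Algebra.Ring_Divisibility" "HOL-Library.Product_Lexorder"
begin

text \<open>Let \<open>m\<close> be the largest part size and \<open>h = min (n - 1) (2 (n - m))\<close>. Interleaving the vertices of the
  largest part with the others gives a path with \<open>h\<close> edges in the graph. For a lexicographic order in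
  which the variables \<open>x\<^sub>1\<^sub>j\<close> decrease along the path, the initial monomials of the corresponding \<open>h\<close>
  generators are pairwise coprime, hence form a regular sequence.

  Then the generators themselves form a regular sequence too (they are a Groebner basis of the ideal they
  generate), so every prime containing the binomial edge ideal \<open>J\<close> ends a chain of \<open>h + 1\<close> primes. For the
  upper bound, \<open>J\<close> contains no nonzero polynomial in the \<open>n + 1\<close> variables \<open>x\<^sub>1\<^sub>1, \<dots>, x\<^sub>1\<^sub>n, x\<^sub>2\<^sub>1\<close>, and
  none in the \<open>2 m\<close> variables of the largest part; a prime over \<open>J\<close> with the same property has height at
  most \<open>n - 1\<close>, respectively \<open>2 (n - m)\<close>, by a dimension count.\<close>

section \<open>Primes avoiding a multiplicative set\<close>

text \<open>By Zorn there is an ideal maximal among those containing \<open>J\<close> and avoiding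
  \<open>M\<close>, and it is prime: if \<open>a\<close> and \<open>b\<close> lie outside it,
  adjoining either one produces an element of \<open>M\<close>, and the product of these two
  elements would lie in the ideal as soon as \<open>a \<otimes> b\<close> does.\<close>

lemma (in cring) exists_primeideal_disjoint:
  assumes J: "ideal J R"
    and M: "M \<subseteq> carrier R" "\<one> \<in> M" "\<And>a b. a \<in> M \<Longrightarrow> b \<in> M \<Longrightarrow> a \<otimes> b \<in> M"
    and disj: "J \<inter> M = {}"
  obtains P where "primeideal P R" "J \<subseteq> P" "P \<inter> M = {}"
proof -
  define A where "A = {I. ideal I R \<and> J \<subseteq> I \<and> I \<inter> M = {}}"
  have "\<exists>P\<in>A. \<forall>X\<in>A. P \<subseteq> X \<longrightarrow> X = P"
  proof (rule subset_Zorn_nonempty)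
    show "A \<noteq> {}" using J disj by (auto simp: A_def)
  next
    fix C assume C: "C \<noteq> {}" "subset.chain A C"
    then have "subset.chain {I. ideal I R} C"
      by (auto simp: subset_chain_def A_def)
    from chain_Union_is_ideal[OF this] C(1) have "ideal (\<Union>C) R" by simp
    with C show "\<Union>C \<in> A" by (fastforce simp: subset_chain_def A_def)
  qed
  then obtain P where P: "P \<in> A" and max: "\<And>I. I \<in> A \<Longrightarrow> P \<subseteq> I \<Longrightarrow> I = P" by blast
  interpret P: ideal P R using P by (simp add: A_def)
  have meet: "\<exists>p\<in>P. \<exists>s\<in>carrier R. p \<oplus> s \<otimes> a \<in> M" if a: "a \<in> carrier R" "a \<notin> P" for a
  proof -
    let ?I = "set_add R P (PIdl a)"
    have I: "ideal ?I R" by (intro add_ideals P.is_ideal cgenideal_ideal a)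
    have mem: "p \<oplus> s \<otimes> a \<in> ?I" if "p \<in> P" "s \<in> carrier R" for p s
      using that by (auto simp: set_add_def' cgenideal_def)
    have sub: "P \<subseteq> ?I"
    proof
      fix p assume p: "p \<in> P"
      with mem[of p \<zero>] a show "p \<in> ?I" by (simp add: P.a_Hcarr)
    qed
    have "a \<in> ?I" using mem[of \<zero> \<one>] a by simp
    with a(2) have "?I \<noteq> P" by auto
    with max[of ?I] sub I have "?I \<notin> A" by blast
    moreover have "J \<subseteq> ?I" using P sub by (auto simp: A_def)
    ultimately obtain x where "x \<in> ?I" "x \<in> M" using I by (auto simp: A_def)
    then show ?thesis by (auto simp: set_add_def' cgenideal_def)
  qed
  have "primeideal P R"
  proof (rule primeidealI)
    show "carrier R \<noteq> P" using P M by (auto simp: A_def)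
  next
    fix a b assume ab: "a \<in> carrier R" "b \<in> carrier R" "a \<otimes> b \<in> P"
    show "a \<in> P \<or> b \<in> P"
    proof (rule ccontr)
      assume "\<not> (a \<in> P \<or> b \<in> P)"
      with meet ab obtain p s q t where *: "p \<in> P" "s \<in> carrier R" "p \<oplus> s \<otimes> a \<in> M"
        "q \<in> P" "t \<in> carrier R" "q \<oplus> t \<otimes> b \<in> M" by meson
      have [simp]: "p \<in> carrier R" "q \<in> carrier R" using * P.a_Hcarr by auto
      have "(p \<oplus> s \<otimes> a) \<otimes> (q \<oplus> t \<otimes> b)
          = (p \<otimes> (q \<oplus> t \<otimes> b) \<oplus> (s \<otimes> a) \<otimes> q) \<oplus> (s \<otimes> t) \<otimes> (a \<otimes> b)"
        using * ab by (simp add: l_distr r_distr m_ac a_ac)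
      also have "\<dots> \<in> P"
        using * ab P.I_r_closed[of p "q \<oplus> t \<otimes> b"] P.I_l_closed[of q "s \<otimes> a"]
          P.I_l_closed[of "a \<otimes> b" "s \<otimes> t"] by (auto intro!: P.a_closed)
      finally show False using M(3)[OF *(3,6)] P by (auto simp: A_def)
    qed
  qed (auto simp: P.is_ideal is_cring)
  with P that show thesis by (auto simp: A_def)
qed

section \<open>A lower bound for heights\<close>

text \<open>For the step, \<open>x\<close> is a nonzerodivisor modulo the ideal \<open>I\<close> generated by its predecessors,
  so the multiplicative set of all \<open>x\<^sup>i s\<close> with \<open>s \<notin> P\<close> avoids \<open>I\<close>; a prime above \<open>I\<close> avoiding
  it is strictly contained in \<open>P\<close>. No minimal primes and no Noetherian hypothesis are needed.\<close>

lemma (in cring) prime_chain_of_nonzerodivisors: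
  assumes "primeideal P R" "set as \<subseteq> P"
    and "\<And>i g. i < length as \<Longrightarrow> g \<in> carrier R \<Longrightarrow> as ! i \<otimes> g \<in> Idl (set (take i as))
      \<Longrightarrow> g \<in> Idl (set (take i as))"
  shows "\<exists>Q :: nat \<Rightarrow> 'a set. (\<forall>i\<le>length as. primeideal (Q i) R) \<and>
    (\<forall>i<length as. Q i \<subset> Q (Suc i)) \<and> Q (length as) = P"
  using assms
proof (induction as arbitrary: P rule: rev_induct)
  case Nil
  then show ?case by (intro exI[of _ "\<lambda>_. P"]) auto
next
  case (snoc x as)
  interpret P: primeideal P R by fact
  have x: "x \<in> P" "x \<in> carrier R" and as: "set as \<subseteq> carrier R" "set as \<subseteq> P"
    using snoc.prems(2) P.a_Hcarr by auto
  let ?I = "Idl (set as)"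
  have I: "ideal ?I R" using as genideal_ideal by blast
  have IP: "?I \<subseteq> P" using as(2) P.is_ideal genideal_minimal by blast
  have reg: "g \<in> ?I" if "g \<in> carrier R" "x \<otimes> g \<in> ?I" for g
    using snoc.prems(3)[of "length as" g] that by simp
  have regp: "g \<in> ?I" if "g \<in> carrier R" "x [^] (k::nat) \<otimes> g \<in> ?I" for g k
    using that
  proof (induction k)
    case 0
    then show ?case by simp
  next
    case (Suc k)
    have "x [^] Suc k \<otimes> g = x \<otimes> (x [^] k \<otimes> g)" using x Suc.prems(1) by (simp add: m_ac)
    with Suc reg[of "x [^] k \<otimes> g"] x show ?case by simp
  qed
  define M where "M = {x [^] (k::nat) \<otimes> s | k s. s \<in> carrier R \<and> s \<notin> P}"
  have "\<one> \<notin> P"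
    using P.I_notcarr P.one_imp_carrier by blast
  have memM: "x [^] (k::nat) \<otimes> s \<in> M" if "s \<in> carrier R" "s \<notin> P" for k s
    using that by (auto simp: M_def)
  obtain Q where Q: "primeideal Q R" "?I \<subseteq> Q" "Q \<inter> M = {}"
  proof (rule exists_primeideal_disjoint[OF I, of M])
    show "M \<subseteq> carrier R" using x by (auto simp: M_def)
    show "\<one> \<in> M" using memM[of \<one> 0] \<open>\<one> \<notin> P\<close> by simp
    show "?I \<inter> M = {}" using regp IP by (auto simp: M_def)
  next
    fix a b assume "a \<in> M" "b \<in> M"
    then obtain k l :: nat and s t where *: "a = x [^] k \<otimes> s" "b = x [^] l \<otimes> t"
      "s \<in> carrier R" "t \<in> carrier R" "s \<notin> P" "t \<notin> P" by (auto simp: M_def)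
    then have "a \<otimes> b = x [^] (k + l) \<otimes> (s \<otimes> t)"
      using x by (simp add: nat_pow_mult[symmetric] m_ac)
    with memM[of "s \<otimes> t" "k + l"] * P.I_prime show "a \<otimes> b \<in> M" by auto
  qed
  interpret Q: primeideal Q R by fact
  \<comment> \<open>With exponent 0, \<open>M\<close> contains the complement of \<open>P\<close>,
    which forces \<open>Q\<close> into \<open>P\<close>; with exponent 1 and
    \<open>s = \<one>\<close> it contains \<open>x\<close>, which makes the inclusion
    strict.\<close>
  have "Q \<subseteq> P"
  proof
    fix s assume s: "s \<in> Q"
    then have "s \<in> carrier R" by (rule Q.a_Hcarr)
    with memM[of s 0] s Q(3) show "s \<in> P" by auto
  qed
  moreover have "x \<notin> Q" using memM[of \<one> 1] \<open>\<one> \<notin> P\<close> x Q(3) by auto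
  ultimately have "Q \<subset> P" using x by auto
  have "\<exists>C :: nat \<Rightarrow> 'a set. (\<forall>i\<le>length as. primeideal (C i) R) \<and>
    (\<forall>i<length as. C i \<subset> C (Suc i)) \<and> C (length as) = Q"
  proof (rule snoc.IH)
    show "set as \<subseteq> Q" using genideal_self[OF as(1)] Q(2) by auto
    show "g \<in> Idl (set (take i as))"
      if "i < length as" "g \<in> carrier R" "as ! i \<otimes> g \<in> Idl (set (take i as))" for i g
      using snoc.prems(3)[of i g] that by (simp add: nth_append)
  qed (fact Q(1))
  then obtain C where C: "\<forall>i\<le>length as. primeideal (C i) R"
    "\<forall>i<length as. C i \<subset> C (Suc i)" "C (length as) = Q" by blast
  show ?case
    using C \<open>Q \<subset> P\<close> snoc.prems(1)
    by (intro exI[of _ "C(Suc (length as) := P)"]) (auto simp: le_Suc_eq less_Suc_eq)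
qed

section \<open>Ideals in polynomial rings\<close>

abbreviation (input) keys where "keys \<equiv> Poly_Mapping.keys"
abbreviation (input) lookup where "lookup \<equiv> Poly_Mapping.lookup"
abbreviation (input) single where "single \<equiv> Poly_Mapping.single"

lemma poly_ring_simps [simp]:
  "(\<otimes>\<^bsub>poly_ring X\<^esub>) = (*)" "\<one>\<^bsub>poly_ring X\<^esub> = 1"
  "\<zero>\<^bsub>poly_ring X\<^esub> = 0" "(\<oplus>\<^bsub>poly_ring X\<^esub>) = (+)"
  by (simp_all add: poly_ring_def)

lemma carrier_poly_ring: "p \<in> carrier (poly_ring X) \<longleftrightarrow> keys p \<subseteq> monomials X"
  by (simp add: poly_ring_def)

lemma poly_eq_sum_single: "p = (\<Sum>m\<in>keys p. single m (lookup p m))"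
  by (rule poly_mapping_eqI) (simp add: lookup_sum lookup_single when_def in_keys_iff)

lemma keys_single_mult_subset: "keys (single u c * p) \<subseteq> (+) u ` keys p"
  using Poly_Mapping.keys_mult[of "single u c" p] by (auto split: if_splits)

lemma zero_in_monomials [simp]: "0 \<in> monomials X"
  by (simp add: monomials_def)

lemma single_in_carrier: "m \<in> monomials X \<Longrightarrow> single m c \<in> carrier (poly_ring X)"
  by (simp add: carrier_poly_ring)

lemma keys_uminus_eq [simp]: "keys (- p :: ('x, 'k::field) mpol) = keys p"
  by (auto simp: in_keys_iff)

lemma poly_ring_a_inv:
  fixes p :: "('x, 'k::field) mpol"
  assumes "p \<in> carrier (poly_ring X)"
  shows "a_inv (poly_ring X) p = - p"
proof -
  interpret cring "poly_ring X :: ('x, 'k) mpol ring" by (rule cring_poly_ring)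
  have "- p \<in> carrier (poly_ring X)" using assms by (auto simp: carrier_poly_ring in_keys_iff)
  with assms show ?thesis by (intro minus_equality) auto
qed

text \<open>Closure under multiplication by single terms is enough, since every polynomial is a
  finite sum of terms; negatives come from the constant \<open>- 1\<close>. This suits ideals
  described by conditions on supports.\<close>

lemma ideal_poly_ringI:
  fixes I :: "('x, 'k::field) mpol set"
  assumes sub: "I \<subseteq> carrier (poly_ring X)" and zero: "0 \<in> I"
    and add: "\<And>p q. p \<in> I \<Longrightarrow> q \<in> I \<Longrightarrow> p + q \<in> I"
    and mult: "\<And>u c p. u \<in> monomials X \<Longrightarrow> p \<in> I \<Longrightarrow> single u c * p \<in> I"
  shows "ideal I (poly_ring X)"
proof -
  interpret cring "poly_ring X :: ('x, 'k) mpol ring" by (rule cring_poly_ring)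
  have sum: "(\<Sum>a\<in>A. h a) \<in> I" if "finite A" "\<And>a. a \<in> A \<Longrightarrow> h a \<in> I" for A and h :: "'x mon \<Rightarrow> _"
    using that by (induction A rule: finite_induct) (auto simp: zero add)
  have mult': "q * p \<in> I" if "p \<in> I" "q \<in> carrier (poly_ring X)" for p q
  proof -
    have "q * p = (\<Sum>m\<in>keys q. single m (lookup q m) * p)"
      by (subst poly_eq_sum_single[of q]) (simp add: sum_distrib_right)
    also have "\<dots> \<in> I" using that by (intro sum mult) (auto simp: carrier_poly_ring)
    finally show ?thesis .
  qed
  have "- p \<in> I" if "p \<in> I" for p
    using mult[of 0 p "- 1"] that by (simp add: single_uminus)
  with sub have "subgroup I (add_monoid (poly_ring X))"
    using zero by (intro add.subgroupI) (auto simp: add poly_ring_a_inv subsetD simp flip: a_inv_def)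
  then show ?thesis
    by (intro idealI ring_axioms) (simp_all add: mult', metis mult' mult.commute)
qed

context
  fixes I :: "('x, 'k::field) mpol set" and X :: "'x set"
  assumes I: "ideal I (poly_ring X)"
begin

lemma ideal_poly_ring_subset: "I \<subseteq> carrier (poly_ring X)"
  using additive_subgroup.a_subset[OF ideal.axioms(1)[OF I]] .

lemma ideal_poly_ring_zero: "0 \<in> I"
  using additive_subgroup.zero_closed[OF ideal.axioms(1)[OF I]] by simp

lemma ideal_poly_ring_add: "p \<in> I \<Longrightarrow> q \<in> I \<Longrightarrow> p + q \<in> I"
  using additive_subgroup.a_closed[OF ideal.axioms(1)[OF I]] by simp

lemma ideal_poly_ring_mult: "p \<in> I \<Longrightarrow> q \<in> carrier (poly_ring X) \<Longrightarrow> q * p \<in> I"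
  using ideal.I_l_closed[OF I] by simp

lemma ideal_poly_ring_diff: "p \<in> I \<Longrightarrow> q \<in> I \<Longrightarrow> p - q \<in> I"
  using ideal_poly_ring_add[of p "- q"] ideal_poly_ring_mult[of q "- 1"]
  by (simp add: carrier_poly_ring)

lemma ideal_poly_ring_sum:
  "(\<And>a. a \<in> A \<Longrightarrow> h a \<in> I) \<Longrightarrow> (\<Sum>a\<in>A. h a) \<in> I"
  by (induction A rule: infinite_finite_induct) (auto simp: ideal_poly_ring_zero ideal_poly_ring_add)

end

lemma ideal_carrier_poly_ring: "ideal (carrier (poly_ring X)) (poly_ring X :: ('x, 'k::field) mpol ring)"
  using cring.axioms(1)[OF cring_poly_ring] by (rule ring.oneideal)

lemmas poly_ring_add_closed = ideal_poly_ring_add[OF ideal_carrier_poly_ring]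
  and poly_ring_mult_closed = ideal_poly_ring_mult[OF ideal_carrier_poly_ring]
  and poly_ring_diff_closed = ideal_poly_ring_diff[OF ideal_carrier_poly_ring]
  and poly_ring_sum_closed = ideal_poly_ring_sum[OF ideal_carrier_poly_ring]

context
  fixes A :: "('x, 'k::field) mpol set" and X :: "'x set"
  assumes A: "A \<subseteq> carrier (poly_ring X)"
begin

interpretation cring "poly_ring X :: ('x, 'k) mpol ring" by (rule cring_poly_ring)

lemma ideal_genideal_poly_ring: "ideal (genideal (poly_ring X) A) (poly_ring X)"
  using A by (rule genideal_ideal)

lemma genideal_poly_ring_self: "A \<subseteq> genideal (poly_ring X) A"
  using A by (rule genideal_self)

end

lemma genideal_poly_ring_minimal:
  "ideal I (poly_ring X) \<Longrightarrow> A \<subseteq> I \<Longrightarrow> genideal (poly_ring X) A \<subseteq> I"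
  by (rule ring.genideal_minimal[OF cring.axioms(1)[OF cring_poly_ring]])

text \<open>Serves to enclose an ideal given by generators: once the generators are supported in
  \<open>U\<close>, no monomial outside \<open>U\<close> occurs in any element of the ideal.\<close>

lemma ideal_monomial_upset:
  fixes U :: "'x mon set"
  assumes "\<And>u m. u \<in> monomials X \<Longrightarrow> m \<in> U \<Longrightarrow> u + m \<in> U"
  shows "ideal {p \<in> carrier (poly_ring X). keys p \<subseteq> U} (poly_ring X :: ('x, 'k::field) mpol ring)"
proof (rule ideal_poly_ringI)
  fix u :: "'x mon" and c :: 'k and p :: "('x, 'k) mpol"
  assume *: "u \<in> monomials X" "p \<in> {p \<in> carrier (poly_ring X). keys p \<subseteq> U}"
  then have "single u c * p \<in> carrier (poly_ring X)"
    by (intro poly_ring_mult_closed single_in_carrier) auto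
  with * assms keys_single_mult_subset[of u c p]
  show "single u c * p \<in> {p \<in> carrier (poly_ring X). keys p \<subseteq> U}" by blast
next
  fix p q :: "('x, 'k) mpol"
  assume "p \<in> {p \<in> carrier (poly_ring X). keys p \<subseteq> U}" "q \<in> {p \<in> carrier (poly_ring X). keys p \<subseteq> U}"
  then show "p + q \<in> {p \<in> carrier (poly_ring X). keys p \<subseteq> U}"
    using Poly_Mapping.keys_add[of p q] poly_ring_add_closed[of p X q] by blast
qed (auto simp: carrier_poly_ring)

section \<open>Weight-lexicographic orders\<close>

definition wt :: "('x \<Rightarrow> nat) \<Rightarrow> 'x mon \<Rightarrow> nat" where
  "wt W m = (\<Sum>x\<in>keys m. W x * lookup m x)"

lemma wt_zero [simp]: "wt W 0 = 0"
  by (simp add: wt_def)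

lemma wt_add: "wt W (a + b) = wt W a + wt W b"
  unfolding wt_def by (rule Poly_Mapping.setsum_keys_plus_distrib) (auto simp: algebra_simps)

lemma wt_single [simp]: "wt W (single x k) = W x * k"
  by (simp add: wt_def)

lemma wt_eq_0: 
  assumes "\<And>x. W x > 0" "wt W m = 0" shows "m = 0"
proof -
  have "\<forall>x\<in>keys m. W x * lookup m x = 0" using assms(2) by (simp add: wt_def)
  then have "x \<notin> keys m" for x using assms(1)[of x] by (force simp: in_keys_iff)
  then show ?thesis by (intro poly_mapping_eqI) (simp add: in_keys_iff)
qed

text \<open>Pairs are compared lexicographically, so the weight decides first and ties are broken by
  the linear order on exponent vectors induced from the variables. Keeping the monomial in the pair
  makes the key injective.\<close>

definition wkey :: "('x::linorder \<Rightarrow> nat) \<Rightarrow> 'x mon \<Rightarrow> nat \<times> 'x mon" where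
  "wkey W m = (wt W m, m)"

lemma wkey_eq_iff [simp]: "wkey W a = wkey W b \<longleftrightarrow> a = b"
  by (auto simp: wkey_def)

lemma wkey_antisym: "wkey W a \<le> wkey W b \<Longrightarrow> wkey W b \<le> wkey W a \<Longrightarrow> a = b"
  using wkey_eq_iff[of W a b] by (simp only: order_antisym)

lemma wkey_add_le_iff [simp]: "wkey W (a + c) \<le> wkey W (b + c) \<longleftrightarrow> wkey W a \<le> wkey W b"
  by (auto simp: wkey_def wt_add)

lemma wkey_le_if_wt_less: "wt W a < wt W b \<Longrightarrow> wkey W a \<le> wkey W b"
  by (simp add: wkey_def)

lemma wkey_add_mono:
  assumes "wkey W a \<le> wkey W a'" "wkey W b \<le> wkey W b'"
  shows "wkey W (a + b) \<le> wkey W (a' + b')"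
proof -
  have "wkey W (a + b) \<le> wkey W (a' + b)" using assms by simp
  also have "\<dots> \<le> wkey W (a' + b')" using assms by (simp add: add.commute[of a'])
  finally show ?thesis .
qed

text \<open>By cancellation. For \<open>lead_mult\<close> this means that the product of two leading
  terms is met by no other pair of terms and hence cannot cancel.\<close>

lemma wkey_add_eq_imp:
  assumes "wkey W a \<le> wkey W a'" "wkey W b \<le> wkey W b'" "a + b = a' + b'"
  shows "a = a'" "b = b'"
proof -
  have "wkey W (a' + b') \<le> wkey W (a' + b)"
    using assms(1) by (simp flip: assms(3))
  then have "wkey W b' \<le> wkey W b" by (simp add: add.commute[of a'])
  with assms(2) show "b = b'" by (rule wkey_antisym)
  with assms(3) show "a = a'" by simp
qed

text \<open>Positive weights make every nonzero exponent vector heavier than \<open>0\<close>, so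
  the tie-break never decides whether \<open>0\<close> is smallest.\<close>

lemma monomial_order_wkey:
  assumes "\<And>x. W x > 0"
  shows "monomial_order X {(m, m'). m \<in> monomials X \<and> m' \<in> monomials X \<and> wkey W m \<le> wkey W m'}"
  unfolding monomial_order_def
proof (intro conjI ballI allI impI)
  show "linear_order_on (monomials X)
      {(m, m'). m \<in> monomials X \<and> m' \<in> monomials X \<and> wkey W m \<le> wkey W m'}"
    unfolding linear_order_on_def partial_order_on_def preorder_on_def
    by (auto simp: refl_on_def trans_def antisym_def total_on_def intro: wkey_antisym)
  show "(0, m) \<in> {(m, m'). m \<in> monomials X \<and> m' \<in> monomials X \<and> wkey W m \<le> wkey W m'}"
    if "m \<in> monomials X" for m
    using that wt_eq_0[of W m] assms wkey_le_if_wt_less[of W 0 m] by (cases "wt W m = 0") auto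
qed (auto simp: monomials_add)

section \<open>Leading monomials of polynomials, products and sums\<close>

definition lead :: "('x::linorder \<Rightarrow> nat) \<Rightarrow> ('x, 'k::zero) mpol \<Rightarrow> 'x mon" where
  "lead W p = snd (Max (wkey W ` keys p))"

lemma lead_in_keys: "p \<noteq> 0 \<Longrightarrow> lead W p \<in> keys p"
  and lead_max: "m \<in> keys p \<Longrightarrow> wkey W m \<le> wkey W (lead W p)"
proof -
  have *: "\<exists>m\<in>keys p. Max (wkey W ` keys p) = wkey W m" if "keys p \<noteq> {}"
    using Max_in[of "wkey W ` keys p"] that by (simp add: image_iff)
  have eq: "lead W p \<in> keys p \<and> wkey W (lead W p) = Max (wkey W ` keys p)" if "keys p \<noteq> {}"
  proof -
    obtain m where "m \<in> keys p" "Max (wkey W ` keys p) = wkey W m" using * \<open>keys p \<noteq> {}\<close> by blast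
    then show ?thesis by (simp only: lead_def) (simp add: wkey_def)
  qed
  show "p \<noteq> 0 \<Longrightarrow> lead W p \<in> keys p" using eq by simp
  assume m: "m \<in> keys p"
  then have "wkey W m \<le> Max (wkey W ` keys p)" by (intro Max_ge) auto
  moreover have "p \<noteq> 0" using m by auto
  ultimately show "wkey W m \<le> wkey W (lead W p)" using eq by simp
qed

lemma lead_eqI:
  assumes "m \<in> keys p" "\<And>m'. m' \<in> keys p \<Longrightarrow> wkey W m' \<le> wkey W m"
  shows "lead W p = m"
proof -
  have "p \<noteq> 0" using assms(1) by auto
  from assms(2)[OF lead_in_keys[OF this]] lead_max[OF assms(1)] show ?thesis by (rule wkey_antisym)
qed

lemma lead_single [simp]: "c \<noteq> 0 \<Longrightarrow> lead W (single m c) = m"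
  by (rule lead_eqI) auto

lemma lookup_mult_keys:
  "lookup (p * q) k = (\<Sum>a\<in>keys p. \<Sum>b\<in>keys q. if a + b = k then lookup p a * lookup q b else 0)"
proof -
  have "p * q = (\<Sum>a\<in>keys p. \<Sum>b\<in>keys q. single (a + b) (lookup p a * lookup q b))"
    by (subst poly_eq_sum_single[of p], subst poly_eq_sum_single[of q])
      (simp add: sum_product mult_single)
  then show ?thesis by (simp add: lookup_sum lookup_single when_def)
qed

lemma lead_mult:
  fixes p q :: "('x::linorder, 'k::field) mpol"
  assumes "p \<noteq> 0" "q \<noteq> 0"
  shows "lead W (p * q) = lead W p + lead W q"
proof (rule lead_eqI)
  have *: "a + b = lead W p + lead W q \<longleftrightarrow> a = lead W p \<and> b = lead W q"
    if "a \<in> keys p" "b \<in> keys q" for a b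
    using wkey_add_eq_imp[OF lead_max[OF that(1)] lead_max[OF that(2)]] by auto
  have "lookup (p * q) (lead W p + lead W q) = (\<Sum>a\<in>keys p. \<Sum>b\<in>keys q.
      if b = lead W q then if a = lead W p then lookup p a * lookup q b else 0 else 0)"
    unfolding lookup_mult_keys by (intro sum.cong) (auto simp: *)
  also have "\<dots> = lookup p (lead W p) * lookup q (lead W q)"
    using assms by (simp add: lead_in_keys)
  finally show "lead W p + lead W q \<in> keys (p * q)"
    using assms lead_in_keys[of p W] lead_in_keys[of q W] by (simp add: in_keys_iff)
next
  fix m assume "m \<in> keys (p * q)"
  then obtain a b where "m = a + b" "a \<in> keys p" "b \<in> keys q"
    using Poly_Mapping.keys_mult[of p q] by auto
  then show "wkey W m \<le> wkey W (lead W p + lead W q)"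
    by (simp add: wkey_add_mono lead_max)
qed

lemma lead_add:
  fixes p q :: "('x::linorder, 'k::field) mpol"
  assumes "p \<noteq> 0" "q \<noteq> 0" "lead W p \<noteq> lead W q"
  shows "lead W (p + q) \<in> {lead W p, lead W q}"
proof -
  have *: "lead W (p + q) = lead W p"
    if "p \<noteq> 0" "wkey W (lead W q) < wkey W (lead W p)" for p q :: "('x, 'k) mpol"
  proof (rule lead_eqI)
    have "lead W p \<notin> keys q" using that lead_max[of "lead W p" q W] by auto
    with lead_in_keys[of p W] that show "lead W p \<in> keys (p + q)"
      by (simp add: in_keys_iff lookup_add)
    show "wkey W m \<le> wkey W (lead W p)" if "m \<in> keys (p + q)" for m
      using that Poly_Mapping.keys_add[of p q] lead_max[of m p W] lead_max[of m q W]
        \<open>wkey W (lead W q) < wkey W (lead W p)\<close> by auto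
  qed
  have "wkey W (lead W q) \<noteq> wkey W (lead W p)" using assms by simp
  then consider "wkey W (lead W q) < wkey W (lead W p)" | "wkey W (lead W p) < wkey W (lead W q)"
    by (metis neq_iff)
  then show ?thesis using *[of p q] *[of q p] assms by cases (simp_all add: add.commute[of q p])
qed

lemma initial_monomial_wkey:
  fixes p :: "('x::linorder, 'k::field) mpol"
  assumes "p \<in> carrier (poly_ring X)" "p \<noteq> 0"
  shows "initial_monomial {(m, m'). m \<in> monomials X \<and> m' \<in> monomials X \<and> wkey W m \<le> wkey W m'} p
    = single (lead W p) 1"
proof -
  have "(THE m. m \<in> keys p \<and> (\<forall>m'\<in>keys p. (m', m) \<in>
      {(m, m'). m \<in> monomials X \<and> m' \<in> monomials X \<and> wkey W m \<le> wkey W m'})) = lead W p"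
    using assms lead_in_keys[of p W] lead_max[of _ p W]
    by (intro the_equality) (auto simp: carrier_poly_ring intro!: lead_eqI[symmetric])
  then show ?thesis by (simp add: initial_monomial_def)
qed

section \<open>Polynomials with pairwise coprime leading monomials\<close>

definition mon_dvd :: "'x mon \<Rightarrow> 'x mon \<Rightarrow> bool" where
  "mon_dvd a m \<longleftrightarrow> (\<forall>x. lookup a x \<le> lookup m x)"

lemma mon_dvdE:
  assumes "mon_dvd a m"
  obtains v where "m = v + a" "keys v \<subseteq> keys m"
proof
  show "m = (m - a) + a"
    using assms by (intro poly_mapping_eqI) (simp add: lookup_add lookup_minus mon_dvd_def)
  show "keys (m - a) \<subseteq> keys m" by (auto simp: in_keys_iff lookup_minus)
qed

lemma mon_dvd_addD_left: "mon_dvd (u + a) m \<Longrightarrow> mon_dvd a m"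
  by (auto simp: mon_dvd_def lookup_add intro: add_leD2)

lemma mon_dvd_add_coprime:
  assumes "mon_dvd a (m + b)" "keys a \<inter> keys b = {}"
  shows "mon_dvd a m"
  unfolding mon_dvd_def
proof
  fix x
  show "lookup a x \<le> lookup m x"
  proof (cases "x \<in> keys a")
    case True
    with assms show ?thesis by (auto simp: mon_dvd_def lookup_add in_keys_iff disjoint_iff dest: spec[of _ x])
  qed (simp add: in_keys_iff)
qed

text \<open>In \<open>wt_tail\<close> the leading monomial wins by weight alone, without the
  tie-break; division is then an induction on natural numbers. For single terms this condition is
  vacuous, so the locale applies both to polynomials and to their initial monomials.\<close>

locale coprime_leads =
  fixes X :: "'x::linorder set" and W :: "'x \<Rightarrow> nat" and f :: "nat \<Rightarrow> ('x, 'k::field) mpol" and h :: nat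
  assumes f_carrier: "i < h \<Longrightarrow> f i \<in> carrier (poly_ring X)"
    and f_nonzero: "i < h \<Longrightarrow> f i \<noteq> 0"
    and wt_tail: "i < h \<Longrightarrow> m \<in> keys (f i) \<Longrightarrow> m \<noteq> lead W (f i) \<Longrightarrow> wt W m < wt W (lead W (f i))"
    and coprime: "i < h \<Longrightarrow> j < h \<Longrightarrow> i \<noteq> j \<Longrightarrow> keys (lead W (f i)) \<inter> keys (lead W (f j)) = {}"
begin

section \<open>Division with remainder\<close>

definition I :: "nat \<Rightarrow> ('x, 'k) mpol set" where
  "I k = genideal (poly_ring X) (f ` {..<k})"

definition normal :: "nat \<Rightarrow> ('x, 'k) mpol set" where
  "normal k = {p \<in> carrier (poly_ring X). \<forall>m\<in>keys p. \<forall>i<k. \<not> mon_dvd (lead W (f i)) m}"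

lemma f_image: "k \<le> h \<Longrightarrow> f ` {..<k} \<subseteq> carrier (poly_ring X)"
  using f_carrier by auto

lemma ideal_I: "k \<le> h \<Longrightarrow> ideal (I k) (poly_ring X)"
  unfolding I_def by (intro ideal_genideal_poly_ring f_image)

lemma I_subset: "k \<le> h \<Longrightarrow> I k \<subseteq> carrier (poly_ring X)"
  using ideal_I ideal_poly_ring_subset by blast

lemma f_in_I: "i < k \<Longrightarrow> k \<le> h \<Longrightarrow> f i \<in> I k"
  unfolding I_def using genideal_poly_ring_self[OF f_image] by blast

lemma normal_add: "p \<in> normal k \<Longrightarrow> q \<in> normal k \<Longrightarrow> p + q \<in> normal k"
  using Poly_Mapping.keys_add[of p q] by (auto simp: normal_def poly_ring_add_closed)

text \<open>The sums of an element of \<open>I k\<close> and a reduced polynomial are closed under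
  addition, so it suffices to treat single terms. A term divisible by some
  \<open>lead W (f i)\<close> is rewritten modulo \<open>f i\<close> into lighter terms.\<close>

lemma division:
  assumes k: "k \<le> h" and p: "p \<in> carrier (poly_ring X)"
  shows "\<exists>q\<in>I k. \<exists>n\<in>normal k. p = q + n"
proof -
  note idl = ideal_I[OF k]
  define D where "D = {q + n | q n. q \<in> I k \<and> n \<in> normal k}"
  have D_add: "a + b \<in> D" if "a \<in> D" "b \<in> D" for a b
  proof -
    from that obtain q n q' n' where "a = q + n" "b = q' + n'" "q \<in> I k" "q' \<in> I k" "n \<in> normal k" "n' \<in> normal k"
      by (auto simp: D_def)
    then have "a + b = (q + q') + (n + n')" "q + q' \<in> I k" "n + n' \<in> normal k"
      by (auto simp: algebra_simps normal_add ideal_poly_ring_add[OF idl])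
    then show ?thesis unfolding D_def by blast
  qed
  have "0 \<in> normal k" by (simp add: normal_def carrier_poly_ring)
  then have I_D: "q \<in> D" if "q \<in> I k" for q using that unfolding D_def by force
  have n_D: "n \<in> D" if "n \<in> normal k" for n
    using that ideal_poly_ring_zero[OF idl] unfolding D_def by force
  have D_sum: "a \<in> D" if "\<And>m. m \<in> keys a \<Longrightarrow> single m (lookup a m) \<in> D" for a
  proof -
    have "(\<Sum>m\<in>A. single m (lookup a m)) \<in> D" if "A \<subseteq> keys a" "finite A" for A
      using that(2,1) \<open>\<And>m. m \<in> keys a \<Longrightarrow> single m (lookup a m) \<in> D\<close>
      by (induction A rule: finite_induct) (auto intro: D_add n_D \<open>0 \<in> normal k\<close>)
    from this[of "keys a"] show ?thesis using poly_eq_sum_single[of a] by simp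
  qed
  have mono: "single m c \<in> D" if "m \<in> monomials X" for m c
    using that
  proof (induction "wt W m" arbitrary: m c rule: less_induct)
    case less
    show ?case
    proof (cases "\<exists>i<k. mon_dvd (lead W (f i)) m")
      case False
      with less.prems show ?thesis by (intro n_D) (auto simp: normal_def single_in_carrier)
    next
      case True
      then obtain i v where i: "i < k" and v: "m = v + lead W (f i)" "keys v \<subseteq> keys m"
        by (meson mon_dvdE)
      let ?L = "lead W (f i)"
      define a where "a = lookup (f i) ?L"
      \<comment> \<open>The scalar \<open>c / a\<close> gives \<open>g\<close> the leading term
        \<open>single m c\<close>. It cancels in \<open>t\<close>, whose monomials are therefore all
        lighter than \<open>m\<close> and fall under the induction hypothesis.\<close>
      define g where "g = single v (c / a) * f i"
      define t where "t = single m c - g"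
      have ih: "i < h" and vX: "v \<in> monomials X" using i k v less.prems by (auto simp: monomials_def)
      have a: "a \<noteq> 0" using lead_in_keys[OF f_nonzero[OF ih], of W] by (simp add: a_def in_keys_iff)
      have "g \<in> I k" unfolding g_def
        using idl f_in_I[OF i k] single_in_carrier[OF vX] by (rule ideal_poly_ring_mult)
      have t: "t \<in> carrier (poly_ring X)" unfolding t_def
        using less.prems \<open>g \<in> I k\<close> I_subset[OF k] by (intro poly_ring_diff_closed single_in_carrier) auto
      have lookup_g: "lookup g (v + u) = c / a * lookup (f i) u" for u
      proof -
        have "lookup g (v + u) = (\<Sum>x\<in>keys (single v (c / a)). \<Sum>b\<in>keys (f i).
            if b = u then lookup (single v (c / a)) x * lookup (f i) b else 0)"
          unfolding g_def lookup_mult_keys by (intro sum.cong) (auto split: if_splits)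
        then show ?thesis by (simp add: in_keys_iff)
      qed
      have "t \<in> D"
      proof (rule D_sum)
        fix u assume u: "u \<in> keys t"
        have "u \<noteq> m" using u lookup_g[of ?L] a by (auto simp: t_def v(1) in_keys_iff lookup_minus a_def)
        with u have "u \<in> keys g" by (auto simp: t_def in_keys_iff lookup_minus lookup_single)
        then obtain w where w: "u = v + w" "w \<in> keys (f i)"
          using keys_single_mult_subset[of v "c / a" "f i"] by (auto simp: g_def)
        with \<open>u \<noteq> m\<close> v(1) wt_tail[OF ih w(2)] have "wt W u < wt W m" by (auto simp: wt_add)
        moreover have "u \<in> monomials X" using t u by (auto simp: carrier_poly_ring)
        ultimately show "single u (lookup t u) \<in> D" by (rule less.hyps)
      qed
      then have "t + g \<in> D" using I_D[OF \<open>g \<in> I k\<close>] by (rule D_add)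
      then show ?thesis by (simp add: t_def)
    qed
  qed
  have "p \<in> D"
  proof (rule D_sum)
    show "single m (lookup p m) \<in> D" if "m \<in> keys p" for m
      using p that by (intro mono) (auto simp: carrier_poly_ring)
  qed
  then show ?thesis by (auto simp: D_def)
qed

section \<open>Leading monomials of ideal elements and nonzerodivisors\<close>

lemma I_SucE:
  assumes k: "k < h" and p: "p \<in> I (Suc k)"
  obtains q g where "q \<in> I k" "g \<in> carrier (poly_ring X)" "p = q + g * f k"
proof -
  note idl = ideal_I[OF less_imp_le[OF k]]
  define J where "J = {q + g * f k | q g. q \<in> I k \<and> g \<in> carrier (poly_ring X)}"
  have mem: "q + g * f k \<in> J" if "q \<in> I k" "g \<in> carrier (poly_ring X)" for q g
    using that by (auto simp: J_def)
  have zero: "0 \<in> I k" "0 \<in> carrier (poly_ring X)"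
    using ideal_poly_ring_zero[OF idl] by (auto simp: carrier_poly_ring)
  have "ideal J (poly_ring X)"
  proof (rule ideal_poly_ringI)
    show "J \<subseteq> carrier (poly_ring X)"
      using I_subset[of k] k f_carrier[OF k]
      by (auto simp: J_def intro!: poly_ring_add_closed poly_ring_mult_closed)
    show "0 \<in> J" using mem[OF zero] by simp
  next
    fix a b assume "a \<in> J" "b \<in> J"
    then obtain q g q' g' where *: "a = q + g * f k" "b = q' + g' * f k" "q \<in> I k" "q' \<in> I k"
      "g \<in> carrier (poly_ring X)" "g' \<in> carrier (poly_ring X)" by (auto simp: J_def)
    then have "a + b = (q + q') + (g + g') * f k" by (simp add: algebra_simps)
    moreover have "(q + q') + (g + g') * f k \<in> J"
      using * by (intro mem poly_ring_add_closed ideal_poly_ring_add[OF idl])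
    ultimately show "a + b \<in> J" by (simp only:)
  next
    fix u :: "'x mon" and c and a assume u: "u \<in> monomials X" and "a \<in> J"
    then obtain q g where *: "a = q + g * f k" "q \<in> I k" "g \<in> carrier (poly_ring X)" by (auto simp: J_def)
    then have "single u c * a = single u c * q + (single u c * g) * f k" by (simp add: algebra_simps)
    moreover have "single u c * q + (single u c * g) * f k \<in> J"
      using * u by (intro mem poly_ring_mult_closed ideal_poly_ring_mult[OF idl] single_in_carrier)
    ultimately show "single u c * a \<in> J" by (simp only:)
  qed
  moreover have "f i \<in> J" if "i < Suc k" for i
  proof (cases "i = k")
    case True
    with mem[OF zero(1), of 1] show ?thesis by (simp add: carrier_poly_ring)
  next
    case False
    with mem[OF f_in_I[of i k] zero(2)] that k show ?thesis by simp
  qed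
  ultimately have "I (Suc k) \<subseteq> J"
    unfolding I_def by (intro genideal_poly_ring_minimal) auto
  with p that show thesis by (auto simp: J_def)
qed

text \<open>A divisor \<open>lead W (f i)\<close> of \<open>lead W n + lead W (f k)\<close> would by
  coprimality divide \<open>lead W n\<close>, which is excluded for reduced
  \<open>n\<close>.\<close>

lemma lead_normal_mult:
  assumes "k < h" "n \<in> normal k" "n \<noteq> 0" "i < k"
  shows "\<not> mon_dvd (lead W (f i)) (lead W (n * f k))"
proof
  assume "mon_dvd (lead W (f i)) (lead W (n * f k))"
  with assms f_nonzero have "mon_dvd (lead W (f i)) (lead W n + lead W (f k))"
    by (simp add: lead_mult)
  then have "mon_dvd (lead W (f i)) (lead W n)"
    by (rule mon_dvd_add_coprime) (use coprime[of i k] assms in auto)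
  with assms lead_in_keys[of n W] show False by (auto simp: normal_def)
qed

text \<open>Buchberger's criterion for coprime leading monomials. Replacing the cofactor of \<open>f k\<close> by its
  normal form \<open>n\<close>, the two summands of an element of \<open>I (Suc k)\<close> cannot have the same leading monomial.\<close>

lemma lead_divisible:
  assumes "k \<le> h" "p \<in> I k" "p \<noteq> 0"
  shows "\<exists>i<k. mon_dvd (lead W (f i)) (lead W p)"
  using assms
proof (induction k arbitrary: p)
  case 0
  have "ideal {0 :: ('x, 'k) mpol} (poly_ring X)"
    by (rule ideal_poly_ringI) (auto simp: carrier_poly_ring)
  then have "I 0 \<subseteq> {0}" unfolding I_def by (intro genideal_poly_ring_minimal) auto
  with 0 show ?case by auto
next
  case (Suc k)
  then have k: "k < h" "k \<le> h" by auto
  note idl = ideal_I[OF k(2)]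
  obtain q g where q: "q \<in> I k" and g: "g \<in> carrier (poly_ring X)" and p: "p = q + g * f k"
    using I_SucE[OF k(1) Suc.prems(2)] by blast
  obtain q' n where q': "q' \<in> I k" and n: "n \<in> normal k" and gn: "g = q' + n"
    using division[OF k(2) g] by auto
  define r where "r = q + f k * q'"
  have r: "r \<in> I k" unfolding r_def
    using q q' f_carrier[OF k(1)] by (intro ideal_poly_ring_add[OF idl] ideal_poly_ring_mult[OF idl])
  have pr: "p = r + n * f k" by (simp add: p gn r_def algebra_simps)
  consider "n = 0" | "n \<noteq> 0" "r = 0" | "n \<noteq> 0" "r \<noteq> 0" by blast
  then show ?case
  proof cases
    case 1
    with Suc.IH[OF k(2) r] Suc.prems(3) pr show ?thesis by (auto intro: less_SucI)
  next
    case 2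
    with pr f_nonzero[OF k(1)] have "lead W p = lead W n + lead W (f k)" by (simp add: lead_mult)
    then show ?thesis by (intro exI[of _ k]) (simp add: mon_dvd_def lookup_add)
  next
    case 3
    obtain i where i: "i < k" "mon_dvd (lead W (f i)) (lead W r)"
      using Suc.IH[OF k(2) r 3(2)] by blast
    have ne: "lead W r \<noteq> lead W (n * f k)"
      using lead_normal_mult[OF k(1) n 3(1) i(1)] i(2) by auto
    have "n * f k \<noteq> 0" using 3 f_nonzero[OF k(1)] by simp
    from lead_add[OF 3(2) this ne] pr
    consider "lead W p = lead W r" | "lead W p = lead W n + lead W (f k)"
      using 3 f_nonzero[OF k(1)] by (auto simp: lead_mult)
    then show ?thesis
    proof cases
      case 1
      with i show ?thesis by (intro exI[of _ i]) auto
    next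
      case 2
      then show ?thesis by (intro exI[of _ k]) (simp add: mon_dvd_def lookup_add)
    qed
  qed
qed

text \<open>Only the remainder \<open>n\<close> of \<open>g\<close> matters, and
  \<open>n * f k\<close> lies in \<open>I k\<close>. If \<open>n\<close> were nonzero,
  \<open>lead_divisible\<close> and \<open>lead_normal_mult\<close> would contradict each
  other.\<close>

lemma nonzerodivisor:
  assumes k: "k < h" and g: "g \<in> carrier (poly_ring X)" and fg: "f k * g \<in> I k"
  shows "g \<in> I k"
proof -
  have k': "k \<le> h" using k by simp
  note idl = ideal_I[OF k']
  obtain q n where q: "q \<in> I k" and n: "n \<in> normal k" and gn: "g = q + n"
    using division[OF k' g] by auto
  have "f k * g - f k * q \<in> I k"
    using fg ideal_poly_ring_mult[OF idl q f_carrier[OF k]] by (rule ideal_poly_ring_diff[OF idl])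
  then have *: "n * f k \<in> I k" by (simp add: gn algebra_simps)
  have "n = 0"
  proof (rule ccontr)
    assume "n \<noteq> 0"
    with lead_divisible[OF k' *] lead_normal_mult[OF k n] f_nonzero[OF k] show False by auto
  qed
  with q gn show ?thesis by simp
qed

lemma regular_sequence:
  assumes "\<And>i. i < h \<Longrightarrow> lead W (f i) \<noteq> 0"
  shows "regular_sequence (poly_ring X) (map f [0..<h])"
proof -
  let ?fs = "map f [0..<h]"
  have take: "genideal (poly_ring X) (set (take i ?fs)) = I i" if "i \<le> h" for i
    using that by (simp add: I_def take_map lessThan_atLeast0)
  \<comment> \<open>The quotient is nonzero because the leading monomial of 1 is \<open>0\<close>,
    which no nonzero leading monomial divides.\<close>
  have "(1 :: ('x, 'k) mpol) \<notin> I h"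
  proof
    assume "(1 :: ('x, 'k) mpol) \<in> I h"
    then obtain i where "i < h" "mon_dvd (lead W (f i)) (lead W (1 :: ('x, 'k) mpol))"
      using lead_divisible[of h 1] by auto
    moreover have "lead W (1 :: ('x, 'k) mpol) = 0" by (rule lead_eqI) auto
    ultimately have "lead W (f i) = 0"
      by (intro poly_mapping_eqI) (auto simp: mon_dvd_def)
    with assms \<open>i < h\<close> show False by simp
  qed
  moreover have "(1 :: ('x, 'k) mpol) \<in> carrier (poly_ring X)" by (simp add: carrier_poly_ring)
  ultimately have "I h \<noteq> carrier (poly_ring X)" by blast
  moreover have "g \<in> genideal (poly_ring X) (set (take i ?fs))"
    if "i < length ?fs" "g \<in> carrier (poly_ring X)"
      "?fs ! i \<otimes>\<^bsub>poly_ring X\<^esub> g \<in> genideal (poly_ring X) (set (take i ?fs))" for i g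
  proof -
    have i: "i < h" using that(1) by simp
    from nonzerodivisor[OF i that(2)] that(3) i show ?thesis unfolding take[OF less_imp_le[OF i]] by simp
  qed
  moreover have "set ?fs \<subseteq> carrier (poly_ring X)" using f_carrier by auto
  moreover have "genideal (poly_ring X) (set ?fs) = I h" using take[of h] by simp
  ultimately show ?thesis unfolding regular_sequence_def by blast
qed

lemma prime_chain:
  assumes P: "primeideal P (poly_ring X)" and fP: "\<And>i. i < h \<Longrightarrow> f i \<in> P"
  shows "\<exists>Q :: nat \<Rightarrow> _ set. (\<forall>i\<le>h. primeideal (Q i) (poly_ring X)) \<and>
    (\<forall>i<h. Q i \<subset> Q (Suc i)) \<and> Q h = P"
proof -
  interpret cring "poly_ring X :: ('x, 'k) mpol ring" by (rule cring_poly_ring)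
  let ?fs = "map f [0..<h]"
  have take: "genideal (poly_ring X) (set (take i ?fs)) = I i" if "i \<le> h" for i
    using that by (simp add: I_def take_map lessThan_atLeast0)
  have "set ?fs \<subseteq> P" using fP by auto
  moreover have "g \<in> genideal (poly_ring X) (set (take i ?fs))"
    if "i < length ?fs" "g \<in> carrier (poly_ring X)"
      "?fs ! i \<otimes>\<^bsub>poly_ring X\<^esub> g \<in> genideal (poly_ring X) (set (take i ?fs))" for i g
  proof -
    have i: "i < h" using that(1) by simp
    from nonzerodivisor[OF i that(2)] that(3) i show ?thesis unfolding take[OF less_imp_le[OF i]] by simp
  qed
  ultimately show ?thesis using prime_chain_of_nonzerodivisors[OF P, of ?fs] by simp
qed

end

section \<open>An upper bound for heights\<close>

definition box :: "'x set \<Rightarrow> nat \<Rightarrow> 'x mon set" where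
  "box X d = {m \<in> monomials X. \<forall>x. lookup m x \<le> d}"

lemma box_mono: "d \<le> e \<Longrightarrow> X \<subseteq> Y \<Longrightarrow> box X d \<subseteq> box Y e"
  by (auto simp: box_def monomials_def intro: order_trans)

lemma box_add: "m \<in> box X d \<Longrightarrow> m' \<in> box X e \<Longrightarrow> m + m' \<in> box X (d + e)"
  by (auto simp: box_def lookup_add monomials_add add_mono)

lemma keys_mult_box:
  "keys p \<subseteq> box X d \<Longrightarrow> keys q \<subseteq> box X e \<Longrightarrow> keys (p * q) \<subseteq> box X (d + e)"
  using Poly_Mapping.keys_mult[of p q] by (fastforce intro: box_add)

lemma keys_power_box:
  fixes p :: "('x, 'k::field) mpol"
  assumes "keys p \<subseteq> box X e" shows "keys (p ^ j) \<subseteq> box X (j * e)"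
proof (induction j)
  case 0
  show ?case by (simp add: box_def)
next
  case (Suc j)
  show ?case using keys_mult_box[OF assms Suc] by simp
qed

lemma bij_betw_box: "finite X \<Longrightarrow> bij_betw (\<lambda>m. restrict (lookup m) X) (box X d) (X \<rightarrow>\<^sub>E {..d})"
  unfolding bij_betw_def
proof
  show "inj_on (\<lambda>m. restrict (lookup m) X) (box X d)"
  proof (rule inj_onI, rule poly_mapping_eqI)
    fix m m' x
    assume *: "m \<in> box X d" "m' \<in> box X d" "restrict (lookup m) X = restrict (lookup m') X"
    show "lookup m x = lookup m' x"
    proof (cases "x \<in> X")
      case True
      with fun_cong[OF *(3), of x] show ?thesis by simp
    next
      case False
      with * have "x \<notin> keys m" "x \<notin> keys m'" by (auto simp: box_def monomials_def)
      then show ?thesis by (simp add: in_keys_iff)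
    qed
  qed
  assume X: "finite X"
  show "(\<lambda>m. restrict (lookup m) X) ` box X d = X \<rightarrow>\<^sub>E {..d}"
  proof (intro equalityI subsetI)
    fix \<phi> assume \<phi>: "\<phi> \<in> X \<rightarrow>\<^sub>E {..d}"
    define m where "m = Poly_Mapping.Abs_poly_mapping (\<lambda>x. if x \<in> X then \<phi> x else 0)"
    have m: "lookup m = (\<lambda>x. if x \<in> X then \<phi> x else 0)"
      unfolding m_def using X by (intro Poly_Mapping.lookup_Abs_poly_mapping) simp
    have "m \<in> box X d" using \<phi> by (auto simp: box_def monomials_def in_keys_iff m split: if_splits)
    moreover have "\<phi> = restrict (lookup m) X"
      using \<phi> by (auto simp: m fun_eq_iff restrict_def PiE_def extensional_def)
    ultimately show "\<phi> \<in> (\<lambda>m. restrict (lookup m) X) ` box X d" by blast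
  qed (auto simp: box_def)
qed

lemma finite_box: "finite X \<Longrightarrow> finite (box X d)"
  using bij_betw_finite[OF bij_betw_box[of X d]] by (simp add: finite_PiE)

text \<open>Bounding each exponent separately, rather than the total degree, gives an exact power as
  the count; the dimension comparison below then needs no binomial coefficients.\<close>

lemma card_box: "finite X \<Longrightarrow> card (box X d) = (d + 1) ^ card X"
  using bij_betw_same_card[OF bij_betw_box[of X d]] by (simp add: card_PiE)

lemma keys_subset_box:
  fixes p :: "('x, 'k::field) mpol"
  assumes "p \<in> carrier (poly_ring X)"
  obtains e where "keys p \<subseteq> box X e"
proof -
  define E where "E m = (\<Sum>y\<in>keys m. lookup m y)" for m :: "'x mon"
  have E: "lookup m x \<le> E m" for m x
    unfolding E_def by (cases "x \<in> keys m") (auto intro: member_le_sum simp: in_keys_iff)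
  have "keys p \<subseteq> box X (\<Sum>m\<in>keys p. E m)"
  proof
    fix m assume m: "m \<in> keys p"
    then have "E m \<le> (\<Sum>m\<in>keys p. E m)" by (intro member_le_sum) auto
    then have "lookup m x \<le> (\<Sum>m\<in>keys p. E m)" for x using E[of m x] by linarith
    with m assms show "m \<in> box X (\<Sum>m\<in>keys p. E m)" by (auto simp: box_def carrier_poly_ring)
  qed
  then show thesis by (rule that)
qed

text \<open>Linear independence over the field of the residue classes modulo \<open>Q\<close>;
  \<open>single 0 (c i)\<close> is the scalar \<open>c i\<close> as a constant polynomial. Families
  are used so that repetitions count as dependence when \<open>Q\<close> contains
  \<open>0\<close>.\<close>

definition independent_mod :: "('x, 'k::field) mpol set \<Rightarrow> 'i set \<Rightarrow> ('i \<Rightarrow> ('x, 'k) mpol) \<Rightarrow> bool" where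
  "independent_mod Q A b \<longleftrightarrow> (\<forall>c. (\<Sum>i\<in>A. single 0 (c i) * b i) \<in> Q \<longrightarrow> (\<forall>i\<in>A. c i = 0))"

lemma independent_modD:
  "independent_mod Q A b \<Longrightarrow> (\<Sum>i\<in>A. single 0 (c i) * b i) \<in> Q \<Longrightarrow> i \<in> A \<Longrightarrow> c i = 0"
  unfolding independent_mod_def by blast

text \<open>Since \<open>0 \<in> Q\<close>, independence modulo \<open>Q\<close> implies ordinary
  linear independence, and all \<open>b i\<close> lie in the span of the monomials in
  \<open>M\<close>.\<close>

lemma card_independent_le:
  fixes b :: "'i \<Rightarrow> ('x, 'k::field) mpol"
  assumes A: "finite A" and ind: "independent_mod Q A b" and zero: "0 \<in> Q"
    and M: "finite M" "\<And>i. i \<in> A \<Longrightarrow> keys (b i) \<subseteq> M"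
  shows "card A \<le> card M"
proof -
  interpret vs: vector_space "\<lambda>c (p :: ('x, 'k) mpol). single 0 c * p"
    by standard (simp_all add: algebra_simps single_add mult_single flip: mult.assoc)
  have inj: "inj_on b A"
  proof (rule inj_onI, rule ccontr)
    fix i j assume ij: "i \<in> A" "j \<in> A" "b i = b j" "i \<noteq> j"
    let ?c = "\<lambda>l. if l = i then 1 else if l = j then - 1 else (0 :: 'k)"
    have "(\<Sum>l\<in>A. single 0 (?c l) * b l) = (\<Sum>l\<in>{i, j}. single 0 (?c l) * b l)"
      using A ij by (intro sum.mono_neutral_right) auto
    also have "\<dots> = 0" using ij by (simp add: single_uminus)
    finally have "(\<Sum>l\<in>A. single 0 (?c l) * b l) \<in> Q" using zero by simp
    from independent_modD[OF ind this ij(1)] show False by simp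
  qed
  have "vs.independent (b ` A)"
  proof
    assume "vs.dependent (b ` A)"
    then obtain u v where u: "v \<in> A" "u (b v) \<noteq> 0" "(\<Sum>p\<in>b ` A. single 0 (u p) * p) = 0"
      using vs.dependent_finite[of "b ` A"] A by auto
    then have "(\<Sum>i\<in>A. single 0 (u (b i)) * b i) \<in> Q" using inj zero by (simp add: sum.reindex)
    from independent_modD[OF ind this u(1)] u(2) show False by simp
  qed
  moreover have "b ` A \<subseteq> vs.span ((\<lambda>m. single m 1) ` M)"
  proof clarify
    fix i assume "i \<in> A"
    have "(\<Sum>m\<in>keys (b i). single 0 (lookup (b i) m) * single m 1) \<in> vs.span ((\<lambda>m. single m 1) ` M)"
      using M(2)[OF \<open>i \<in> A\<close>] by (intro vs.span_sum vs.span_scale vs.span_base) auto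
    then show "b i \<in> vs.span ((\<lambda>m. single m 1) ` M)"
      using poly_eq_sum_single[of "b i"] by (simp add: mult_single)
  qed
  ultimately have "card (b ` A) \<le> card ((\<lambda>m. single m 1 :: ('x, 'k) mpol) ` M)"
    using vs.independent_span_bound[of "(\<lambda>m. single m 1) ` M" "b ` A"] M(1) by simp
  also have "\<dots> \<le> card M" by (rule card_image_le) fact
  finally show ?thesis using inj by (simp add: card_image)
qed

text \<open>A lower bound of order \<open>d\<^sup>k\<close> for the dimension of the image of the polynomials with exponents
  \<open>O(d)\<close> in the quotient by \<open>Q\<close>; it replaces the transcendence degree of the quotient.\<close>

definition growth :: "'x set \<Rightarrow> ('x, 'k::field) mpol set \<Rightarrow> nat \<Rightarrow> bool" where
  "growth X Q k \<longleftrightarrow> (\<exists>D. \<forall>d. \<exists>(A :: nat set) b. finite A \<and> card A = (d + 1) ^ k \<and>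
     (\<forall>i\<in>A. keys (b i) \<subseteq> box X (D * d)) \<and> independent_mod Q A b)"

text \<open>The monomials in \<open>box Y d\<close> are independent modulo \<open>P\<close>: a
  combination of them lying in \<open>P\<close> involves only variables from \<open>Y\<close> and
  therefore vanishes.\<close>

lemma growth_base:
  fixes P :: "('x, 'k::field) mpol set"
  assumes X: "finite X" "Y \<subseteq> X" and P: "\<And>p. p \<in> P \<Longrightarrow> keys p \<subseteq> monomials Y \<Longrightarrow> p = 0"
  shows "growth X P (card Y)"
  unfolding growth_def
proof (intro exI[of _ 1] allI)
  fix d
  have Y: "finite Y" using X finite_subset by blast
  obtain g where g: "bij_betw g {0..<card (box Y d)} (box Y d)"
    using ex_bij_betw_nat_finite[OF finite_box[OF Y]] by blast
  let ?A = "{0..<card (box Y d)}"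
  have "independent_mod P ?A (\<lambda>i. single (g i) 1)"
    unfolding independent_mod_def
  proof (intro allI impI ballI)
    fix c i
    let ?p = "\<Sum>i\<in>?A. single 0 (c i) * single (g i) (1 :: 'k)"
    assume p: "?p \<in> P" and i: "i \<in> ?A"
    have inj: "j \<in> ?A \<Longrightarrow> g j = g i \<longleftrightarrow> j = i" for j
      using g i by (auto simp: bij_betw_def inj_on_def)
    have "keys ?p \<subseteq> (\<Union>i\<in>?A. {g i})"
      by (rule order.trans[OF Poly_Mapping.keys_sum]) (auto simp: mult_single split: if_splits)
    also have "\<dots> \<subseteq> monomials Y" using g by (auto simp: bij_betw_def box_def)
    finally have "?p = 0" by (rule P[OF p])
    then have "0 = lookup ?p (g i)" by simp
    also have "\<dots> = (\<Sum>j\<in>?A. if j = i then c j else 0)"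
      unfolding lookup_sum by (intro sum.cong) (auto simp: mult_single lookup_single when_def inj)
    also have "\<dots> = c i" using i by simp
    finally show "c i = 0" by simp
  qed
  moreover have "g i \<in> box X (1 * d)" if "i \<in> ?A" for i
    using that g box_mono[OF order.refl X(2), of d] by (auto simp: bij_betw_def)
  ultimately show "\<exists>(A :: nat set) b. finite A \<and> card A = (d + 1) ^ card Y \<and>
      (\<forall>i\<in>A. keys (b i) \<subseteq> box X (1 * d)) \<and> independent_mod P A b"
    using card_box[OF Y, of d] by (intro exI[of _ ?A] exI[of _ "\<lambda>i. single (g i) 1"]) simp
qed

text \<open>For \<open>f\<close> in \<open>Q'\<close> but not in \<open>Q\<close>, the products
  \<open>f ^ j * b a\<close> with \<open>j \<le> d\<close> are independent modulo \<open>Q\<close>,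
  which gains a factor \<open>d + 1\<close>. In a relation, the part with \<open>j = 0\<close> lies
  in \<open>Q'\<close>, so its coefficients vanish; as \<open>Q\<close> is prime and misses
  \<open>f\<close>, the rest may be divided by \<open>f\<close>, and the argument repeats.\<close>

lemma growth_step:
  fixes Q Q' :: "('x, 'k::field) mpol set"
  assumes Q: "primeideal Q (poly_ring X)" and Q': "primeideal Q' (poly_ring X)" and lt: "Q \<subset> Q'"
    and growth: "growth X Q' k"
  shows "growth X Q (Suc k)"
proof -
  interpret Q: primeideal Q "poly_ring X" by fact
  interpret Q': primeideal Q' "poly_ring X" by fact
  note Q_ideal = Q.is_ideal and Q'_ideal = Q'.is_ideal
  obtain f where f: "f \<in> Q'" "f \<notin> Q" using lt by auto
  have fc: "f \<in> carrier (poly_ring X)" using f Q'.a_Hcarr by simp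
  obtain e where e: "keys f \<subseteq> box X e" using keys_subset_box[OF fc] by blast
  obtain D where D: "\<And>d. \<exists>(A :: nat set) b. finite A \<and> card A = (d + 1) ^ k \<and>
     (\<forall>i\<in>A. keys (b i) \<subseteq> box X (D * d)) \<and> independent_mod Q' A b"
    using growth unfolding growth_def by blast
  show ?thesis unfolding growth_def
  proof (intro exI[of _ "D + e"] allI)
    fix d
    obtain A :: "nat set" and b where A: "finite A" "card A = (d + 1) ^ k"
      and b: "\<And>i. i \<in> A \<Longrightarrow> keys (b i) \<subseteq> box X (D * d)" and ind: "independent_mod Q' A b"
      using D[of d] by blast
    have bc: "b i \<in> carrier (poly_ring X)" if "i \<in> A" for i
      using b[OF that] by (auto simp: carrier_poly_ring box_def)
    define s where "s c = (\<Sum>a\<in>A. single 0 (c a) * b a)" for c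
    have sc: "s c \<in> carrier (poly_ring X)" for c
      unfolding s_def by (intro poly_ring_sum_closed poly_ring_mult_closed bc single_in_carrier) auto
    have pc: "f ^ j \<in> carrier (poly_ring X)" for j
    proof (induction j)
      case (Suc j)
      with poly_ring_mult_closed[OF Suc fc] show ?case by simp
    qed (simp add: carrier_poly_ring)
    have key: "\<forall>j<n. \<forall>a\<in>A. c j a = 0" if "(\<Sum>j<n. f ^ j * s (c j)) \<in> Q" for n and c :: "nat \<Rightarrow> nat \<Rightarrow> 'k"
      using that
    proof (induction n arbitrary: c)
      case (Suc n)
      let ?r = "\<Sum>j<n. f ^ j * s (c (Suc j))"
      have rc: "?r \<in> carrier (poly_ring X)"
        by (intro poly_ring_sum_closed poly_ring_mult_closed sc pc)
      have eq: "(\<Sum>j<Suc n. f ^ j * s (c j)) = s (c 0) + f * ?r"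
        by (subst sum.lessThan_Suc_shift) (simp add: sum_distrib_left mult.assoc)
      have "s (c 0) + f * ?r \<in> Q'" using Suc.prems lt unfolding eq by blast
      moreover have "f * ?r \<in> Q'"
        using ideal_poly_ring_mult[OF Q'_ideal f(1) rc] by (simp add: mult.commute)
      ultimately have "s (c 0) + f * ?r - f * ?r \<in> Q'" by (rule ideal_poly_ring_diff[OF Q'_ideal])
      then have c0: "\<forall>a\<in>A. c 0 a = 0"
        using ind unfolding independent_mod_def s_def by simp
      then have "s (c 0) = 0" by (simp add: s_def)
      with Suc.prems eq have "f * ?r \<in> Q" by simp
      with Q.I_prime[OF fc rc] f have "?r \<in> Q" by auto
      then have "\<forall>j<n. \<forall>a\<in>A. c (Suc j) a = 0" by (rule Suc.IH)
      with c0 show ?case by (auto simp: less_Suc_eq_0_disj)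
    qed simp
    \<comment> \<open>The pairs \<open>(j, a)\<close> are encoded as numbers because
      \<open>growth\<close> asks for index sets of naturals.\<close>
    let ?A = "prod_encode ` ({..<Suc d} \<times> A)"
    let ?b = "\<lambda>i. case prod_decode i of (j, a) \<Rightarrow> f ^ j * b a"
    have inj: "inj_on prod_encode ({..<Suc d} \<times> A)"
      by (rule inj_prod_encode)
    have "independent_mod Q ?A ?b"
      unfolding independent_mod_def
    proof (intro allI impI ballI)
      fix c i assume *: "(\<Sum>i\<in>?A. single 0 (c i) * ?b i) \<in> Q" and i: "i \<in> ?A"
      have "(\<Sum>i\<in>?A. single 0 (c i) * ?b i)
          = (\<Sum>(j, a)\<in>{..<Suc d} \<times> A. single 0 (c (prod_encode (j, a))) * (f ^ j * b a))"
        by (subst sum.reindex[OF inj]) (auto intro!: sum.cong)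
      also have "\<dots> = (\<Sum>j<Suc d. f ^ j * s (\<lambda>a. c (prod_encode (j, a))))"
        by (simp only: sum.cartesian_product[symmetric] s_def sum_distrib_left mult_ac)
      finally have "(\<Sum>j<Suc d. f ^ j * s (\<lambda>a. c (prod_encode (j, a)))) \<in> Q" using * by (simp only:)
      then have zero: "\<forall>j<Suc d. \<forall>a\<in>A. c (prod_encode (j, a)) = 0" by (rule key)
      from i obtain j a where "i = prod_encode (j, a)" "j < Suc d" "a \<in> A" by auto
      with zero show "c i = 0" by blast
    qed
    moreover have "card ?A = (d + 1) ^ Suc k"
      using A by (simp add: card_image[OF inj] card_cartesian_product)
    moreover have "keys (?b i) \<subseteq> box X ((D + e) * d)" if "i \<in> ?A" for i
    proof -
      from that obtain j a where ja: "i = prod_encode (j, a)" "j \<le> d" "a \<in> A" by auto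
      have "keys (f ^ j * b a) \<subseteq> box X (j * e + D * d)"
        by (intro keys_mult_box keys_power_box e b ja)
      also have "\<dots> \<subseteq> box X ((D + e) * d)"
        using ja(2) by (intro box_mono) (auto simp: algebra_simps)
      finally show ?thesis using ja by simp
    qed
    ultimately show "\<exists>(A :: nat set) b. finite A \<and> card A = (d + 1) ^ Suc k \<and>
        (\<forall>i\<in>A. keys (b i) \<subseteq> box X ((D + e) * d)) \<and> independent_mod Q A b"
      using A(1) by (intro exI[of _ ?A] exI[of _ ?b]) auto
  qed
qed

text \<open>At most \<open>(D * d + 1) ^ card X\<close> polynomials supported in the box can be
  independent, a bound of order \<open>card X\<close> in \<open>d\<close>, whereas growth provides
  \<open>(d + 1) ^ k\<close> of them.\<close>

lemma growth_le_card:
  assumes X: "finite X" and zero: "0 \<in> Q" and growth: "growth X Q k"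
  shows "k \<le> card X"
proof (rule ccontr)
  assume "\<not> k \<le> card X"
  then have k: "Suc (card X) \<le> k" by simp
  obtain D where D: "\<And>d. \<exists>(A :: nat set) b. finite A \<and> card A = (d + 1) ^ k \<and>
     (\<forall>i\<in>A. keys (b i) \<subseteq> box X (D * d)) \<and> independent_mod Q A b"
    using growth unfolding growth_def by blast
  have "(d + 1) ^ k \<le> (D * d + 1) ^ card X" for d
  proof -
    obtain A :: "nat set" and b where A: "finite A" "card A = (d + 1) ^ k"
      and b: "\<And>i. i \<in> A \<Longrightarrow> keys (b i) \<subseteq> box X (D * d)" and ind: "independent_mod Q A b"
      using D[of d] by blast
    from card_independent_le[OF A(1) ind zero finite_box[OF X] b] A(2) show ?thesis
      by (simp add: card_box[OF X])
  qed
  also have "(D * d + 1) ^ card X \<le> ((D + 1) * (d + 1)) ^ card X" for d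
    by (intro power_mono) (auto simp: algebra_simps)
  finally have *: "(d + 1) ^ k \<le> (D + 1) ^ card X * (d + 1) ^ card X" for d
    by (simp only: power_mult_distrib)
  \<comment> \<open>If \<open>k\<close> exceeded \<open>card X\<close>, the inequality would leave a
    factor \<open>d + 1\<close> bounded by \<open>(D + 1) ^ card X\<close>; this \<open>d\<close>
    refutes it.\<close>
  define d where "d = (D + 1) ^ card X"
  have "(d + 1) * (d + 1) ^ card X \<le> (d + 1) ^ k"
    using power_increasing[OF k, of "d + 1"] by simp
  also have "\<dots> \<le> d * (d + 1) ^ card X" using *[of d] by (simp only: d_def)
  finally show False by simp
qed

text \<open>Descending a chain of primes from \<open>P\<close>, every strict inclusion raises the
  growth exponent by one. It starts at \<open>card Y\<close> and can never exceed
  \<open>card X\<close>.\<close>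

lemma prime_height_le:
  fixes P :: "('x, 'k::field) mpol set"
  assumes X: "finite X" "Y \<subseteq> X" and P: "\<And>p. p \<in> P \<Longrightarrow> keys p \<subseteq> monomials Y \<Longrightarrow> p = 0"
  shows "prime_height (poly_ring X) P \<le> enat (card X - card Y)"
  unfolding prime_height_def
proof (rule Sup_least, clarify)
  fix m and Q :: "nat \<Rightarrow> ('x, 'k) mpol set"
  assume prime: "\<forall>i\<le>m. primeideal (Q i) (poly_ring X)" and lt: "\<forall>i<m. Q i \<subset> Q (Suc i)" and PQ: "P = Q m"
  have "growth X (Q (m - i)) (card Y + i)" if "i \<le> m" for i
    using that
  proof (induction i)
    case 0
    show ?case using growth_base[OF X P] by (simp add: PQ)
  next
    case (Suc i)
    then have "growth X (Q (m - i)) (card Y + i)" by simp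
    moreover have "Q (m - Suc i) \<subset> Q (m - i)"
      using lt[rule_format, of "m - Suc i"] Suc.prems by (simp add: Suc_diff_Suc)
    ultimately have "growth X (Q (m - Suc i)) (Suc (card Y + i))"
      using prime by (intro growth_step[of "Q (m - Suc i)" X "Q (m - i)"]) simp_all
    then show ?case by simp
  qed
  from this[of m] have "growth X (Q 0) (card Y + m)" by simp
  moreover have "0 \<in> Q 0"
    using prime primeideal.axioms(1) by (intro ideal_poly_ring_zero) blast
  ultimately show "enat m \<le> enat (card X - card Y)"
    using growth_le_card[OF X(1)] by fastforce
qed

text \<open>The nonzero polynomials in the variables \<open>Y\<close> form a multiplicative set
  disjoint from \<open>J\<close>; a prime over \<open>J\<close> that still avoids them falls under
  \<open>prime_height_le\<close>.\<close>

lemma ideal_height_le: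
  fixes J :: "('x::linorder, 'k::field) mpol set"
  assumes X: "finite X" "Y \<subseteq> X" and J: "ideal J (poly_ring X)"
    and JY: "\<And>p. p \<in> J \<Longrightarrow> keys p \<subseteq> monomials Y \<Longrightarrow> p = 0"
  shows "ideal_height (poly_ring X) J \<le> enat (card X - card Y)"
proof -
  interpret cring "poly_ring X :: ('x, 'k) mpol ring" by (rule cring_poly_ring)
  let ?M = "{p :: ('x, 'k) mpol. keys p \<subseteq> monomials Y \<and> p \<noteq> 0}"
  obtain P where P: "primeideal P (poly_ring X)" "J \<subseteq> P" "P \<inter> ?M = {}"
  proof (rule exists_primeideal_disjoint[OF J, of ?M])
    show "?M \<subseteq> carrier (poly_ring X)" using X(2) by (fastforce simp: carrier_poly_ring monomials_def)
    show "\<one>\<^bsub>poly_ring X\<^esub> \<in> ?M" by simp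
    show "p \<otimes>\<^bsub>poly_ring X\<^esub> q \<in> ?M" if "p \<in> ?M" "q \<in> ?M" for p q
      using that poly_ring_mult_closed[of q Y p] by (simp add: carrier_poly_ring)
    show "J \<inter> ?M = {}" using JY by blast
  qed
  have "ideal_height (poly_ring X) J \<le> prime_height (poly_ring X) P"
    unfolding ideal_height_def using P by (intro Inf_lower) blast
  also have "\<dots> \<le> enat (card X - card Y)"
    using P(3) by (intro prime_height_le X) blast
  finally show ?thesis .
qed

section \<open>Binomial edge ideals\<close>

definition diag_mon :: "nat \<Rightarrow> nat \<Rightarrow> (nat \<times> nat) mon" where
  "diag_mon k l = single (1, k) 1 + single (2, l) 1"

definition minor :: "nat \<Rightarrow> nat \<Rightarrow> (nat \<times> nat, 'k::field) mpol" where
  "minor k l = var (1, k) * var (2, l) - var (1, l) * var (2, k)"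

lemma minor_eq: "minor k l = single (diag_mon k l) 1 - single (diag_mon l k) 1"
  by (simp add: minor_def var_def diag_mon_def mult_single)

lemma lookup_diag_mon:
  "lookup (diag_mon k l) x = (if x = (1, k) \<or> x = (2, l) then 1 else 0)"
  by (auto simp: diag_mon_def lookup_add lookup_single when_def)

lemma keys_diag_mon: "keys (diag_mon k l) = {(1, k), (2, l)}"
  by (auto simp: in_keys_iff lookup_diag_mon split: if_splits)

lemma keys_add_mon: "keys (a + b :: 'x mon) = keys a \<union> keys b"
  by (auto simp: in_keys_iff lookup_add)

lemma diag_mon_eq_iff [simp]: "diag_mon k l = diag_mon k' l' \<longleftrightarrow> k = k' \<and> l = l'"
proof
  assume "diag_mon k l = diag_mon k' l'"
  then have "keys (diag_mon k l) = keys (diag_mon k' l')" by simp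
  then have "{(1 :: nat, k), (2, l)} = {(1, k'), (2, l')}" by (simp only: keys_diag_mon)
  then show "k = k' \<and> l = l'" by (auto simp: doubleton_eq_iff)
qed simp

lemma diag_mon_dvd_iff: "mon_dvd (diag_mon k l) (diag_mon k' l') \<longleftrightarrow> k = k' \<and> l = l'"
proof
  assume *: "mon_dvd (diag_mon k l) (diag_mon k' l')"
  from *[unfolded mon_dvd_def, rule_format, of "(1, k)"] *[unfolded mon_dvd_def, rule_format, of "(2, l)"]
  show "k = k' \<and> l = l'" by (auto simp: lookup_diag_mon split: if_splits)
qed (auto simp: mon_dvd_def)

lemma mon_degree_diag_mon: "mon_degree (diag_mon k l) = 2"
  by (simp add: mon_degree_def keys_diag_mon lookup_diag_mon)

lemma keys_minor: "k \<noteq> l \<Longrightarrow> keys (minor k l :: (nat \<times> nat, 'k::field) mpol) = {diag_mon k l, diag_mon l k}"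
  by (auto simp: minor_eq in_keys_iff lookup_minus lookup_single when_def split: if_splits)

lemma diag_mon_in_monomials: "k \<in> {1..n} \<Longrightarrow> l \<in> {1..n} \<Longrightarrow> diag_mon k l \<in> monomials (bei_vars n)"
  by (auto simp: monomials_def keys_diag_mon bei_vars_def)

lemma minor_in_carrier:
  assumes "k \<in> {1..n}" "l \<in> {1..n}"
  shows "minor k l \<in> carrier (poly_ring (bei_vars n))"
  unfolding minor_eq using assms
  by (intro poly_ring_diff_closed single_in_carrier diag_mon_in_monomials)

section \<open>The generators attached to the edges and their minimality\<close>

definition edge_minors :: "nat set set \<Rightarrow> (nat \<times> nat, 'k::field) mpol set" where
  "edge_minors E = {minor k l | k l. {k, l} \<in> E \<and> k < l}"

lemma binomial_edge_ideal_eq: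
  "binomial_edge_ideal n E = genideal (poly_ring (bei_vars n)) (edge_minors E)"
  by (simp add: binomial_edge_ideal_def edge_minors_def minor_def)

lemma edge_minors_carrier:
  "\<Union>E \<subseteq> {1..n} \<Longrightarrow> edge_minors E \<subseteq> carrier (poly_ring (bei_vars n))"
  by (auto simp: edge_minors_def intro!: minor_in_carrier)

lemma ideal_binomial_edge_ideal:
  "\<Union>E \<subseteq> {1..n} \<Longrightarrow> ideal (binomial_edge_ideal n E :: (nat \<times> nat, 'k::field) mpol set) (poly_ring (bei_vars n))"
  unfolding binomial_edge_ideal_eq by (rule ideal_genideal_poly_ring[OF edge_minors_carrier])

text \<open>The monomials of a generator occur in no other generator; since all generators are
  quadrics, they do not occur in the ideal generated by the others either.\<close>

lemma minimal_homogeneous_generators_edge_minors: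
  assumes E: "\<Union>E \<subseteq> {1..n}"
  shows "minimal_homogeneous_generators (bei_vars n)
    (binomial_edge_ideal n E :: (nat \<times> nat, 'k::field) mpol set) (edge_minors E)"
  unfolding minimal_homogeneous_generators_def
proof (intro conjI allI impI ballI)
  show "edge_minors E \<subseteq> carrier (poly_ring (bei_vars n))" by (rule edge_minors_carrier[OF E])
  show "genideal (poly_ring (bei_vars n)) (edge_minors E) = binomial_edge_ideal n E"
    by (simp add: binomial_edge_ideal_eq)
  show "homogeneous f" if "f \<in> edge_minors E" for f :: "(nat \<times> nat, 'k) mpol"
  proof -
    from that obtain k l where "f = minor k l" "k < l" by (auto simp: edge_minors_def)
    then show ?thesis by (auto simp: homogeneous_def keys_minor mon_degree_diag_mon)
  qed
next
  fix G :: "(nat \<times> nat, 'k) mpol set"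
  assume G: "G \<subset> edge_minors E"
  then obtain k l where kl: "k < l" "(minor k l :: (nat \<times> nat, 'k) mpol) \<in> edge_minors E" "minor k l \<notin> G"
    by (auto simp: edge_minors_def)
  \<comment> \<open>Excluding all divisors of \<open>diag_mon k l\<close>, not just this monomial,
    makes the support condition stable under multiplication.\<close>
  define I :: "(nat \<times> nat, 'k) mpol set" where
    "I = {p \<in> carrier (poly_ring (bei_vars n)). keys p \<subseteq> {m. \<not> mon_dvd m (diag_mon k l)}}"
  have "ideal I (poly_ring (bei_vars n))"
    unfolding I_def by (rule ideal_monomial_upset) (auto dest: mon_dvd_addD_left)
  moreover have "G \<subseteq> I"
  proof
    fix f assume f: "f \<in> G"
    with G have "f \<in> edge_minors E" by blast
    then obtain a b where ab: "f = minor a b" "a < b" by (auto simp: edge_minors_def)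
    with f kl have "\<not> (a = k \<and> b = l)" "\<not> (b = k \<and> a = l)" by auto
    with f G ab edge_minors_carrier[OF E] show "f \<in> I"
      by (auto simp: I_def keys_minor diag_mon_dvd_iff)
  qed
  ultimately have "genideal (poly_ring (bei_vars n)) G \<subseteq> I" by (rule genideal_poly_ring_minimal)
  moreover have "minor k l \<notin> I" using kl by (auto simp: I_def keys_minor diag_mon_dvd_iff)
  moreover have "(minor k l :: (nat \<times> nat, 'k) mpol) \<in> binomial_edge_ideal n E"
    using kl genideal_poly_ring_self[OF edge_minors_carrier[OF E]] by (auto simp: binomial_edge_ideal_eq)
  ultimately show "genideal (poly_ring (bei_vars n)) G \<noteq> binomial_edge_ideal n E" by blast
qed

text \<open>The locale \<open>coprime_leads\<close> is used twice: for the path generators it yields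
  chains of primes and so the lower bound \<open>h\<close> for the height, for their initial
  monomials it yields the regular sequence.\<close>

lemma koenig_type_of_path:
  fixes v :: "nat \<Rightarrow> nat"
  assumes E: "\<Union>E \<subseteq> {1..n}" and inj: "inj_on v {..h}"
    and edge: "\<And>t. t < h \<Longrightarrow> {v t, v (Suc t)} \<in> E"
    and height: "ideal_height (poly_ring (bei_vars n))
      (binomial_edge_ideal n E :: (nat \<times> nat, 'k::field) mpol set) \<le> enat h"
  shows "koenig_type (bei_vars n) (binomial_edge_ideal n E :: (nat \<times> nat, 'k) mpol set)"
proof -
  let ?X = "bei_vars n"
  let ?J = "binomial_edge_ideal n E :: (nat \<times> nat, 'k) mpol set"
  \<comment> \<open>The variables \<open>x\<^sub>1\<^sub>j\<close> get lighter along the path, so that the initial monomial of the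
    \<open>t\<close>-th edge is \<open>x\<^bsub>1,v t\<^esub> x\<^bsub>2,v (t+1)\<^esub>\<close>, whatever the orientation of the edge.\<close>
  define w where "w j = h - the_inv_into {..h} v j" for j
  define W where "W = (\<lambda>(i, j). if i = (1 :: nat) then Suc (w j) else 1)"
  define f :: "nat \<Rightarrow> (nat \<times> nat, 'k) mpol" where
    "f t = minor (min (v t) (v (Suc t))) (max (v t) (v (Suc t)))" for t
  define L where "L t = diag_mon (v t) (v (Suc t))" for t
  define r where "r = {(m, m'). m \<in> monomials ?X \<and> m' \<in> monomials ?X \<and> wkey W m \<le> wkey W m'}"
  \<comment> \<open>The \<open>Suc\<close> in \<open>W\<close> guarantees this also for vertices off
    the path, where \<open>w\<close> takes unspecified values.\<close>
  have W_pos: "W x > 0" for x by (auto simp: W_def split: prod.split)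
  have w: "w (v t) = h - t" if "t \<le> h" for t
    using that inj by (simp add: w_def the_inv_into_f_f)
  have ne: "v t \<noteq> v (Suc t)" if "t < h" for t
    using inj_onD[OF inj, of t "Suc t"] that by auto
  have keys_f: "keys (f t) = {L t, diag_mon (v (Suc t)) (v t)}" if "t < h" for t
    using ne[OF that] by (cases "v t < v (Suc t)") (auto simp: f_def L_def min_def max_def keys_minor)
  have f_edge: "f t \<in> edge_minors E" if "t < h" for t
    using ne[OF that] edge[OF that]
    by (cases "v t < v (Suc t)") (fastforce simp: f_def edge_minors_def min_def max_def insert_commute)+
  have f_carrier: "f t \<in> carrier (poly_ring ?X)" if "t < h" for t
    using f_edge[OF that] edge_minors_carrier[OF E] by blast
  have f_nonzero: "f t \<noteq> 0" if "t < h" for t using keys_f[OF that] by auto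
  have wt_diag: "wt W (diag_mon a b) = w a + 2" for a b
    by (simp add: diag_mon_def wt_add W_def)
  \<comment> \<open>The values of \<open>w\<close> at \<open>v t\<close> and
    \<open>v (Suc t)\<close> are \<open>h - t\<close> and \<open>h - t - 1\<close>, so the two terms
    of \<open>f t\<close> differ in weight by exactly one.\<close>
  have tail: "wt W m < wt W (L t)" if "t < h" "m \<in> keys (f t)" "m \<noteq> L t" for t m
    using that keys_f[OF that(1)] w[of t] w[of "Suc t"] by (auto simp: L_def wt_diag)
  have lead_f: "lead W (f t) = L t" if "t < h" for t
    by (rule lead_eqI) (use keys_f[OF that] tail[OF that] wkey_le_if_wt_less in fastforce)+
  \<comment> \<open>A path vertex starts at most one edge and ends at most one edge; starting points
    contribute variables of row 1, end points variables of row 2.\<close>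
  have L_disj: "keys (L i) \<inter> keys (L j) = {}" if "i < h" "j < h" "i \<noteq> j" for i j
    using that inj_onD[OF inj, of i j] inj_onD[OF inj, of "Suc i" "Suc j"]
    by (auto simp: L_def keys_diag_mon)
  interpret f: coprime_leads ?X W f h
    by standard (use f_carrier f_nonzero tail lead_f L_disj in simp_all)
  interpret L: coprime_leads ?X W "\<lambda>t. single (L t) (1 :: 'k)" h
  proof
    show "single (L t) (1 :: 'k) \<in> carrier (poly_ring ?X)" if "t < h" for t
      using f_carrier[OF that] keys_f[OF that] by (auto simp: carrier_poly_ring)
    show "single (L t) (1 :: 'k) \<noteq> 0" for t
      by (metis lookup_single_eq lookup_zero zero_neq_one)
  qed (use L_disj in auto)
  have f_J: "f t \<in> ?J" if "t < h" for t
    using f_edge[OF that] genideal_poly_ring_self[OF edge_minors_carrier[OF E]]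
    by (auto simp: binomial_edge_ideal_eq)
  have "enat h \<le> ideal_height (poly_ring ?X) ?J"
    unfolding ideal_height_def
  proof (rule Inf_greatest, clarify)
    fix P :: "(nat \<times> nat, 'k) mpol set"
    assume "primeideal P (poly_ring ?X)" "?J \<subseteq> P"
    with f.prime_chain[of P] f_J show "enat h \<le> prime_height (poly_ring ?X) P"
      unfolding prime_height_def by (intro Sup_upper) blast
  qed
  with height have "ideal_height (poly_ring ?X) ?J = enat h" by (rule order_antisym)
  moreover have "distinct (map f [0..<h])"
  proof -
    have "L i \<noteq> L j" if "i < h" "j < h" "i \<noteq> j" for i j
      using L_disj[OF that] by (auto simp: L_def keys_diag_mon)
    then have "inj_on f {0..<h}" using lead_f by (metis atLeastLessThan_iff inj_onI)
    then show ?thesis by (simp add: distinct_map)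
  qed
  moreover have "set (map f [0..<h]) \<subseteq> edge_minors E" using f_edge by auto
  moreover have "monomial_order ?X r" unfolding r_def by (rule monomial_order_wkey[OF W_pos])
  moreover have "regular_sequence (poly_ring ?X) (map (initial_monomial r) (map f [0..<h]))"
  proof -
    have "map (initial_monomial r) (map f [0..<h]) = map (\<lambda>t. single (L t) (1 :: 'k)) [0..<h]"
      unfolding r_def using f_carrier f_nonzero lead_f by (simp add: initial_monomial_wkey)
    moreover have "L t \<noteq> 0" for t
    proof
      assume "L t = 0"
      then have "keys (L t) = {}" by simp
      then show False by (simp add: L_def keys_diag_mon)
    qed
    ultimately show ?thesis using L.regular_sequence by (simp only: lead_single one_neq_zero simp_thms not_False_eq_True)
  qed
  ultimately show ?thesis
    unfolding koenig_type_def
    using minimal_homogeneous_generators_edge_minors[OF E, where ?'k = 'k]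
    by (intro exI[of _ h] exI[of _ "edge_minors E"] exI[of _ "map f [0..<h]"] exI[of _ r]) simp
qed

section \<open>Two bounds for the height of a binomial edge ideal\<close>

lemma card_bei_vars: "finite (bei_vars n)" "card (bei_vars n) = 2 * n"
  by (simp_all add: bei_vars_def card_cartesian_product)

text \<open>No edge lies inside \<open>V\<close>, so both terms of every generator contain a
  variable at a vertex outside \<open>V\<close>. The same then holds for every monomial occurring in
  the ideal.\<close>

lemma ideal_height_vertex_cover:
  assumes E: "\<Union>E \<subseteq> {1..n}" and V: "V \<subseteq> {1..n}"
    and indep: "\<And>k l. {k, l} \<in> E \<Longrightarrow> k \<notin> V \<or> l \<notin> V"
  shows "ideal_height (poly_ring (bei_vars n))
    (binomial_edge_ideal n E :: (nat \<times> nat, 'k::field) mpol set) \<le> enat (2 * (n - card V))"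
proof -
  let ?X = "bei_vars n" and ?Y = "{1, 2 :: nat} \<times> V"
  let ?J = "binomial_edge_ideal n E :: (nat \<times> nat, 'k) mpol set"
  let ?I = "{p :: (nat \<times> nat, 'k) mpol. p \<in> carrier (poly_ring ?X) \<and> keys p \<subseteq> - monomials ?Y}"
  have "ideal ?I (poly_ring ?X)"
    by (rule ideal_monomial_upset) (auto simp: monomials_def keys_add_mon)
  moreover have "edge_minors E \<subseteq> ?I"
  proof
    fix f :: "(nat \<times> nat, 'k) mpol"
    assume f: "f \<in> edge_minors E"
    then obtain k l where kl: "f = minor k l" "k < l" "{k, l} \<in> E" by (auto simp: edge_minors_def)
    with indep[of k l] f edge_minors_carrier[OF E] show "f \<in> ?I"
      by (auto simp: keys_minor monomials_def keys_diag_mon)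
  qed
  ultimately have sub: "?J \<subseteq> ?I"
    unfolding binomial_edge_ideal_eq by (rule genideal_poly_ring_minimal)
  have "ideal_height (poly_ring ?X) ?J \<le> enat (card ?X - card ?Y)"
  proof (rule ideal_height_le[OF _ _ ideal_binomial_edge_ideal[OF E]])
    show "p = 0" if "p \<in> ?J" "keys p \<subseteq> monomials ?Y" for p
    proof -
      have "keys p = {}" using that sub by blast
      then show ?thesis by simp
    qed
  qed (use V card_bei_vars in \<open>auto simp: bei_vars_def\<close>)
  also have "card ?X - card ?Y = 2 * (n - card V)"
    by (simp add: card_bei_vars card_cartesian_product diff_mult_distrib2)
  finally show ?thesis .
qed

text \<open>The kernel of the linear map induced by \<open>m \<mapsto> \<psi> m\<close> on monomials.\<close>

lemma ideal_fibre_sums: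
  fixes \<psi> :: "'x mon \<Rightarrow> 'c"
  assumes \<psi>: "\<And>u m m'. \<psi> (u + m) = \<psi> (u + m') \<longleftrightarrow> \<psi> m = \<psi> m'"
  shows "ideal {p \<in> carrier (poly_ring X). \<forall>e. (\<Sum>m\<in>keys p. if \<psi> m = e then lookup p m else 0) = 0}
    (poly_ring X :: ('x, 'k::field) mpol ring)"
proof -
  define S :: "'c \<Rightarrow> ('x, 'k) mpol \<Rightarrow> 'k" where
    "S e p = (\<Sum>m\<in>keys p. if \<psi> m = e then lookup p m else 0)" for e p
  have S_zero: "S e 0 = 0" for e by (simp add: S_def)
  have S_add: "S e (p + q) = S e p + S e q" for e p q
    unfolding S_def by (rule Poly_Mapping.setsum_keys_plus_distrib) auto
  have S_sum: "S e (\<Sum>a\<in>A. g a) = (\<Sum>a\<in>A. S e (g a))" for e A and g :: "'x mon \<Rightarrow> _"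
    by (induction A rule: infinite_finite_induct) (simp_all add: S_zero S_add)
  have S_single: "S e (single m c) = (if \<psi> m = e then c else 0)" for e m c
    by (simp add: S_def)
  have S_mult: "S e (single u c * p) = 0" if p: "\<And>e. S e p = 0" for e u c p
  proof -
    have "single u c * p = (\<Sum>m\<in>keys p. single (u + m) (c * lookup p m))"
      by (subst poly_eq_sum_single[of p]) (simp add: sum_distrib_left mult_single)
    then have eq: "S e (single u c * p) = (\<Sum>m\<in>keys p. if \<psi> (u + m) = e then c * lookup p m else 0)"
      by (simp add: S_sum S_single)
    \<comment> \<open>If \<open>e\<close> is the label of some \<open>u + m'\<close>, the hypothesis
      on \<open>\<psi>\<close> identifies the sum over the fibre of \<open>e\<close> with
      \<open>c\<close> times the one over the fibre of \<open>\<psi> m'\<close>; otherwise the sum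
      has only zero entries.\<close>
    show ?thesis
    proof (cases "\<exists>m. \<psi> (u + m) = e")
      case True
      then obtain m' where "e = \<psi> (u + m')" by auto
      with eq have "S e (single u c * p) = (\<Sum>m\<in>keys p. c * (if \<psi> m = \<psi> m' then lookup p m else 0))"
        by (simp add: \<psi> if_distrib cong: if_cong)
      also have "\<dots> = c * S (\<psi> m') p" by (simp add: S_def sum_distrib_left)
      finally show ?thesis by (simp add: p)
    qed (simp add: eq)
  qed
  have "ideal {p \<in> carrier (poly_ring X). \<forall>e. S e p = 0} (poly_ring X)"
    by (rule ideal_poly_ringI)
      (auto simp: S_zero S_add S_mult carrier_poly_ring[of 0] poly_ring_add_closed
        intro!: poly_ring_mult_closed single_in_carrier)
  then show ?thesis unfolding S_def .
qed

text \<open>The ideal lies in the kernel of a substitution that is injective on monomials in the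
  \<open>n + 1\<close> variables \<open>?Y\<close>: there the exponent of the new variable is that
  of \<open>x\<^sub>2\<^sub>1\<close>, and the exponents in row 1 are then determined. This leaves
  \<open>2 * n - (n + 1)\<close>.\<close>

lemma ideal_height_vertices:
  assumes E: "\<Union>E \<subseteq> {1..n}" and n: "n \<ge> 1"
  shows "ideal_height (poly_ring (bei_vars n))
    (binomial_edge_ideal n E :: (nat \<times> nat, 'k::field) mpol set) \<le> enat (n - 1)"
proof -
  let ?X = "bei_vars n" and ?Y = "insert (2 :: nat, 1 :: nat) ({1} \<times> {1..n})"
  let ?J = "binomial_edge_ideal n E :: (nat \<times> nat, 'k) mpol set"
  \<comment> \<open>This is the substitution \<open>x\<^sub>2\<^sub>j \<mapsto> y x\<^sub>1\<^sub>j\<close>, which kills all minors.\<close>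
  define W :: "nat \<times> nat \<Rightarrow> nat" where "W x = (if fst x = 2 then 1 else 0)" for x
  define \<psi> where "\<psi> m = (\<lambda>j. lookup m (1, j) + lookup m (2, j), wt W m)" for m :: "(nat \<times> nat) mon"
  let ?I = "{p :: (nat \<times> nat, 'k) mpol. p \<in> carrier (poly_ring ?X) \<and>
    (\<forall>e. (\<Sum>m\<in>keys p. if \<psi> m = e then lookup p m else 0) = 0)}"
  have "\<psi> (u + m) = \<psi> (u + m') \<longleftrightarrow> \<psi> m = \<psi> m'" for u m m'
    by (auto simp: \<psi>_def wt_add lookup_add fun_eq_iff)
  then have "ideal ?I (poly_ring ?X)" by (rule ideal_fibre_sums)
  moreover have "edge_minors E \<subseteq> ?I"
  proof
    fix f :: "(nat \<times> nat, 'k) mpol"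
    assume f: "f \<in> edge_minors E"
    then obtain k l where kl: "f = minor k l" "k \<noteq> l" by (auto simp: edge_minors_def)
    have "\<psi> (diag_mon k l) = \<psi> (diag_mon l k)"
      by (auto simp: \<psi>_def lookup_diag_mon diag_mon_def wt_add W_def fun_eq_iff lookup_add lookup_single when_def)
    then have "(\<Sum>m\<in>keys f. if \<psi> m = e then lookup f m else 0) = 0" for e
      using kl by (simp add: keys_minor) (simp add: minor_eq lookup_minus lookup_single when_def)
    with f edge_minors_carrier[OF E] show "f \<in> ?I" by blast
  qed
  ultimately have sub: "?J \<subseteq> ?I"
    unfolding binomial_edge_ideal_eq by (rule genideal_poly_ring_minimal)
  have \<psi>_inj: "m = m'" if "\<psi> m = \<psi> m'" "m \<in> monomials ?Y" "m' \<in> monomials ?Y" for m m'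
  proof -
    have zero: "lookup m (i, j) = 0" if "m \<in> monomials ?Y" "i \<noteq> 1" "(i, j) \<noteq> (2, 1)" for m i j
      using that by (auto simp: monomials_def in_keys_iff subset_iff)
    have wt: "wt W m = lookup m (2, 1)" if "m \<in> monomials ?Y" for m
    proof -
      have "W x * lookup m x = (if x = (2, 1) then lookup m x else 0)" if "x \<in> keys m" for x
      proof -
        have "x = (2, 1) \<or> fst x = 1" using that \<open>m \<in> monomials ?Y\<close> by (auto simp: monomials_def)
        then show ?thesis by (auto simp: W_def)
      qed
      then have "wt W m = (\<Sum>x\<in>keys m. if x = (2, 1) then lookup m x else 0)"
        unfolding wt_def by (rule sum.cong[OF refl])
      then show ?thesis by (simp add: in_keys_iff)
    qed
    have eq2: "lookup m (2, j) = lookup m' (2, j)" for j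
      using that wt[OF that(2)] wt[OF that(3)] zero[OF that(2), of 2 j] zero[OF that(3), of 2 j]
      by (cases "j = 1") (auto simp: \<psi>_def)
    have "lookup m (1, j) = lookup m' (1, j)" for j
      using that(1) eq2[of j] by (auto simp: \<psi>_def dest: fun_cong[of _ _ j])
    with eq2 zero[OF that(2)] zero[OF that(3)] have "lookup m (i, j) = lookup m' (i, j)" for i j
      by (cases "i = 1"; cases "i = 2") auto
    then show ?thesis by (intro poly_mapping_eqI) auto
  qed
  have "ideal_height (poly_ring ?X) ?J \<le> enat (card ?X - card ?Y)"
  proof (rule ideal_height_le[OF _ _ ideal_binomial_edge_ideal[OF E]])
    show "p = 0" if p: "p \<in> ?J" "keys p \<subseteq> monomials ?Y" for p
    proof (rule ccontr)
      assume "p \<noteq> 0"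
      then obtain m where m: "m \<in> keys p" by (metis ex_in_conv keys_eq_empty)
      have "0 = (\<Sum>m'\<in>keys p. if \<psi> m' = \<psi> m then lookup p m' else 0)"
        using subsetD[OF sub p(1)] by (simp only: mem_Collect_eq)
      also have "\<dots> = (\<Sum>m'\<in>keys p. if m' = m then lookup p m' else 0)"
      proof (rule sum.cong[OF refl])
        fix m' assume "m' \<in> keys p"
        with p(2) m have "\<psi> m' = \<psi> m \<longleftrightarrow> m' = m" using \<psi>_inj[of m' m] by blast
        then show "(if \<psi> m' = \<psi> m then lookup p m' else 0) = (if m' = m then lookup p m' else 0)" by simp
      qed
      also have "\<dots> = lookup p m" using m by simp
      finally show False using m by (simp add: in_keys_iff)
    qed
  qed (use n card_bei_vars in \<open>auto simp: bei_vars_def\<close>)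
  also have "card ?Y = n + 1" by (subst card_insert_disjoint) (auto simp: card_cartesian_product)
  then have "card ?X - card ?Y = n - 1" by (simp add: card_bei_vars)
  finally show ?thesis .
qed

section \<open>Long paths in complete multipartite graphs\<close>

text \<open>In a list sorted by colour, equal colours at \<open>p\<close> and \<open>q\<close> force
  the same colour on all positions between them.\<close>

lemma card_colour_interval:
  fixes c :: "'a \<Rightarrow> 'b::linorder"
  assumes "distinct ys" "sorted (map c ys)" "p \<le> q" "q < length ys" "c (ys ! p) = c (ys ! q)"
  shows "q - p + 1 \<le> card {y \<in> set ys. c y = c (ys ! p)}"
proof -
  have "(!) ys ` {p..q} \<subseteq> {y \<in> set ys. c y = c (ys ! p)}"
  proof clarify
    fix t assume t: "t \<in> {p..q}"
    then have "c (ys ! p) \<le> c (ys ! t)" "c (ys ! t) \<le> c (ys ! q)"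
      using assms sorted_nth_mono[OF assms(2), of p t] sorted_nth_mono[OF assms(2), of t q] by auto
    with assms t show "ys ! t \<in> set ys \<and> c (ys ! t) = c (ys ! p)" by auto
  qed
  then have "card ((!) ys ` {p..q}) \<le> card {y \<in> set ys. c y = c (ys ! p)}"
    by (intro card_mono) auto
  moreover have "card ((!) ys ` {p..q}) = q - p + 1"
    using assms by (subst card_image) (auto simp: inj_on_def nth_eq_iff_index_eq)
  ultimately show ?thesis by simp
qed

text \<open>List the vertices colour by colour, a largest class first and truncated so that at most half of
  the list (rounded up) has its colour; then interleave the two halves of the list. Two neighbours of
  the result have distance \<open>k\<close> or \<open>k - 1\<close> in the list, where \<open>k\<close> is half its length, rounded up.\<close>

lemma exists_alternating_path:
  fixes c :: "'a \<Rightarrow> 'b::linorder"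
  assumes V: "finite V" "V \<noteq> {}" and max: "\<And>j. card {x \<in> V. c x = j} \<le> card {x \<in> V. c x = i}"
  defines "h \<equiv> min (card V - 1) (2 * (card V - card {x \<in> V. c x = i}))"
  obtains v where "inj_on v {..h}" "v ` {..h} \<subseteq> V" "\<And>t :: nat. t < h \<Longrightarrow> c (v t) \<noteq> c (v (Suc t))"
proof -
  define A where "A = {x \<in> V. c x = i}"
  define a where "a = card A"
  define b where "b = card (V - A)"
  have fin: "finite A" "A \<subseteq> V" using V by (auto simp: A_def)
  have card_V: "card V = a + b"
    using fin V card_Diff_subset[of A V] card_mono[of V A] by (simp add: a_def b_def)
  obtain x where "x \<in> V" using V by blast
  then have "card {y \<in> V. c y = c x} \<noteq> 0" using V by auto
  with max[of "c x"] have a_pos: "a \<ge> 1" by (simp add: a_def A_def)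
  \<comment> \<open>Since \<open>h = min (a + b - 1) (2 * b)\<close>, the \<open>h + 1\<close>
    vertices of the path consist of all \<open>b\<close> vertices outside the class and
    \<open>min a (b + 1)\<close> vertices inside it.\<close>
  define a' where "a' = min a (b + 1)"
  have h: "h + 1 = a' + b" using card_V a_pos by (auto simp: h_def a_def A_def a'_def)
  obtain xs where xs: "set xs = A" "distinct xs" "length xs = a"
    using finite_distinct_list[OF fin(1)] distinct_card a_def by metis
  obtain ys0 where ys0: "set ys0 = V - A" "distinct ys0"
    using finite_distinct_list[of "V - A"] V by auto
  define ys where "ys = sort_key c ys0"
  have ys: "set ys = V - A" "distinct ys" "sorted (map c ys)"
    using ys0 by (auto simp: ys_def)
  then have len_ys: "length ys = b" using distinct_card[of ys] by (simp add: b_def)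
  define zs where "zs = take a' xs @ ys"
  have len: "length zs = h + 1" using h len_ys xs by (simp add: zs_def a'_def)
  have dist: "distinct zs" using xs ys by (auto simp: zs_def dest: in_set_takeD)
  have set_zs: "set zs \<subseteq> V" using xs ys fin by (auto simp: zs_def dest: in_set_takeD)
  have first: "c (zs ! p) = i" if "p < a'" for p
  proof -
    have "zs ! p = xs ! p" "p < length xs" using that xs by (auto simp: zs_def nth_append a'_def)
    then show ?thesis using xs(1) nth_mem[of p xs] by (simp add: A_def)
  qed
  have rest: "zs ! p = ys ! (p - a')" "p - a' < length ys" if "a' \<le> p" "p \<le> h" for p
    using that xs len_ys h by (auto simp: zs_def nth_append a'_def)
  \<comment> \<open>Equal colours occur only within the initial block, or beyond it at distance less
    than \<open>a'\<close>: a further class has at most \<open>a\<close> elements by maximality, and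
    at most \<open>b\<close> because it avoids \<open>A\<close>.\<close>
  have same: "q < a' \<or> (a' \<le> p \<and> q - p + 1 \<le> a')"
    if pq: "p \<le> q" "q \<le> h" and eq: "c (zs ! p) = c (zs ! q)" for p q
  proof (cases "q < a'")
    case False
    then have q: "zs ! q = ys ! (q - a')" "q - a' < length ys" using rest pq by auto
    then have "zs ! q \<in> V - A" using nth_mem[OF q(2)] ys(1) by simp
    then have "c (zs ! q) \<noteq> i" by (simp add: A_def)
    with eq first[of p] have p: "a' \<le> p" by (cases "p < a'") auto
    with pq have p': "zs ! p = ys ! (p - a')" using rest by auto
    let ?C = "{y \<in> set ys. c y = c (ys ! (p - a'))}"
    have "(q - a') - (p - a') + 1 \<le> card ?C"
      using pq q p' eq by (intro card_colour_interval ys) auto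
    moreover have "card ?C \<le> card {y \<in> V. c y = c (ys ! (p - a'))}"
      using ys(1) V by (intro card_mono) auto
    moreover have "card ?C \<le> b" unfolding b_def using ys(1) V by (intro card_mono) auto
    ultimately have "q - p + 1 \<le> a'"
      using max[of "c (ys ! (p - a'))"] p pq by (simp add: a'_def a_def A_def)
    with p show ?thesis by blast
  qed simp
  define k where "k = (h + 2) div 2"
  \<comment> \<open>From \<open>a' \<le> b + 1\<close> follows \<open>2 * a' \<le> h + 2\<close>, so
    the initial block fits into the first half of the list.\<close>
  have k: "a' \<le> k" "h \<le> 2 * k - 1" "k \<ge> 1" using h by (auto simp: k_def a'_def)
  define idx where "idx t = (if even t then t div 2 else k + t div 2)" for t :: nat
  have idx_le: "idx t \<le> h" if "t \<le> h" for t
    using that by (auto simp: idx_def k_def elim!: oddE)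
  have idx_inj: "inj_on idx {..h}"
  proof (rule inj_onI)
    fix s t assume st: "s \<in> {..h}" "t \<in> {..h}" "idx s = idx t"
    have "r div 2 < k" if "r \<le> h" for r using that by (auto simp: k_def)
    with st have "even s \<longleftrightarrow> even t" "s div 2 = t div 2" by (fastforce simp: idx_def split: if_splits)+
    then show "s = t" by (metis dvd_mult_div_cancel odd_two_times_div_two_succ)
  qed
  have neq: "c (zs ! idx t) \<noteq> c (zs ! idx (Suc t))" if t: "t < h" for t
  proof (cases "even t")
    case True
    then obtain s where s: "t = 2 * s" by auto
    then have *: "idx t = s" "idx (Suc t) = k + s" by (auto simp: idx_def)
    show ?thesis
    proof
      assume "c (zs ! idx t) = c (zs ! idx (Suc t))"
      \<comment> \<open>Position \<open>k + s\<close> is beyond the initial block, and the distance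
        \<open>k\<close> is at least \<open>a'\<close>, so \<open>same\<close> excludes equal
        colours.\<close>
      with same[of s "k + s"] idx_le[of "Suc t"] t k show False by (auto simp: *)
    qed
  next
    case False
    then obtain s where s: "t = 2 * s + 1" by (auto elim: oddE)
    then have *: "idx t = k + s" "idx (Suc t) = s + 1" by (auto simp: idx_def)
    show ?thesis
    proof
      assume "c (zs ! idx t) = c (zs ! idx (Suc t))"
      then have "c (zs ! (s + 1)) = c (zs ! (k + s))" by (simp only: *)
      moreover have "k + s \<le> h" using idx_le[of t] t by (simp add: *)
      \<comment> \<open>At distance \<open>k - 1\<close>, \<open>same\<close> leaves only the case
        \<open>k = a'\<close> and \<open>s + 1 \<ge> a'\<close>; then
        \<open>t = 2 * s + 1 \<ge> 2 * k - 1 \<ge> h\<close>, contrary to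
        \<open>t < h\<close>.\<close>
      ultimately show False using same[of "s + 1" "k + s"] t k s by auto
    qed
  qed
  show thesis
  proof (rule that[of "\<lambda>t. zs ! idx t"])
    show "inj_on (\<lambda>t. zs ! idx t) {..h}"
      using idx_le idx_inj dist len by (auto simp: inj_on_def nth_eq_iff_index_eq less_Suc_eq_le)
    show "(\<lambda>t. zs ! idx t) ` {..h} \<subseteq> V"
      using idx_le set_zs len by (auto simp: less_Suc_eq_le intro!: subsetD[OF set_zs] nth_mem)
  qed (rule neq)
qed

section \<open>Parts as consecutive intervals, and the theorem\<close>

lemma part_eq_iff:
  assumes "v \<in> part ns a" "v \<in> part ns b" "a \<ge> 1" "b \<ge> 1"
  shows "a = b"
proof -
  have False if "v \<in> part ns a" "v \<in> part ns b" "a < b" for a b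
  proof -
    have "(\<Sum>j=1..a. ns j) \<le> (\<Sum>j=1..<b. ns j)" using that by (intro sum_mono2) auto
    with that show False by (auto simp: Defs.part_def)
  qed
  with assms show ?thesis by (meson linorder_neqE_nat)
qed

lemma Union_part: "(\<Union>a\<in>{1..r}. part ns a) = {1..\<Sum>j=1..r. ns j}"
proof (induction r)
  case (Suc r)
  have "(\<Union>a\<in>{1..Suc r}. part ns a) = (\<Union>a\<in>{1..r}. part ns a) \<union> part ns (Suc r)"
    by (auto simp: atLeastAtMostSuc_conv)
  also have "\<dots> = {1..\<Sum>j=1..Suc r. ns j}"
    unfolding Suc by (auto simp: Defs.part_def atLeastLessThanSuc_atLeastAtMost)
  finally show ?case .
qed simp

lemma card_part: "a \<ge> 1 \<Longrightarrow> card (part ns a) = ns a"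
  by (cases a) (simp_all add: Defs.part_def atLeastLessThanSuc_atLeastAtMost)

theorem proposition3p13:
  fixes r n :: nat and ns :: "nat \<Rightarrow> nat"
  assumes "r \<ge> 2"
    and "\<And>j. j \<in> {1..r} \<Longrightarrow> ns j \<ge> 1"
    and "n = (\<Sum>j=1..r. ns j)"
  shows "koenig_type (bei_vars n)
    (binomial_edge_ideal n (complete_multipartite_edges r ns) :: (nat \<times> nat, 'k::field) mpol set)"
proof -
  let ?E = "complete_multipartite_edges r ns" and ?V = "{1..n}"
  have V: "?V = (\<Union>a\<in>{1..r}. part ns a)" using Union_part[of ns r] assms(3) by simp
  then have "\<forall>x\<in>?V. \<exists>a. a \<in> {1..r} \<and> x \<in> part ns a" by blast
  \<comment> \<open>The colour of a vertex is the index of its part, so edges are exactly the pairs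
    of vertices with different colours.\<close>
  then obtain c where c: "\<And>x. x \<in> ?V \<Longrightarrow> c x \<in> {1..r} \<and> x \<in> part ns (c x)" by metis
  have part_V: "x \<in> ?V" if "x \<in> part ns a" "a \<in> {1..r}" for x a using V that by blast
  have c_eq: "c x = a" if "x \<in> part ns a" "a \<in> {1..r}" for x a
    using part_eq_iff[OF _ that(1), of "c x"] c[OF part_V[OF that]] that(2) by auto
  have E_sub: "\<Union>?E \<subseteq> ?V"
    using part_V unfolding complete_multipartite_edges_def by blast
  have E_ne: "c k \<noteq> c l" if kl: "{k, l} \<in> ?E" for k l
  proof -
    from kl obtain u w a b where "{k, l} = {u, w}" "a \<in> {1..r}" "b \<in> {1..r}" "a \<noteq> b"
      "u \<in> part ns a" "w \<in> part ns b" unfolding complete_multipartite_edges_def by blast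
    with c_eq[of u a] c_eq[of w b] show ?thesis by (auto simp: doubleton_eq_iff)
  qed
  have E_I: "{k, l} \<in> ?E" if "k \<in> ?V" "l \<in> ?V" "c k \<noteq> c l" for k l
    using c[OF that(1)] c[OF that(2)] that(3) unfolding complete_multipartite_edges_def by blast
  \<comment> \<open>Indices outside \<open>{1..r}\<close> are included because the path lemma
    requires maximality among all colours.\<close>
  have colour_class: "{x \<in> ?V. c x = j} = (if j \<in> {1..r} then part ns j else {})" for j
    using c c_eq part_V by auto
  have "Max (ns ` {1..r}) \<in> ns ` {1..r}" using assms(1) by (intro Max_in) auto
  then obtain i where i: "i \<in> {1..r}" "ns i = Max (ns ` {1..r})" by auto
  have max: "card {x \<in> ?V. c x = j} \<le> card {x \<in> ?V. c x = i}" for j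
    unfolding colour_class using i by (simp add: card_part)
  have "ns 1 \<le> n" unfolding assms(3) by (rule member_le_sum) (use assms(1) in auto)
  with assms(1) assms(2)[of 1] have n: "n \<ge> 1" by simp
  \<comment> \<open>The two entries are the bounds of \<open>ideal_height_vertices\<close> and, for
    the largest part as independent set, \<open>ideal_height_vertex_cover\<close>; their minimum is
    the length of the alternating path.\<close>
  define h where "h = min (n - 1) (2 * (n - ns i))"
  have h: "h = min (card ?V - 1) (2 * (card ?V - card {x \<in> ?V. c x = i}))"
    unfolding colour_class using i(1) by (simp add: h_def card_part)
  have "?V \<noteq> {}" using n by simp
  from exists_alternating_path[OF _ this max] obtain v where v: "inj_on v {..h}" "v ` {..h} \<subseteq> ?V"
    "\<And>t. t < h \<Longrightarrow> c (v t) \<noteq> c (v (Suc t))" unfolding h by auto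
  show ?thesis
  proof (rule koenig_type_of_path[OF E_sub v(1)])
    show "{v t, v (Suc t)} \<in> ?E" if "t < h" for t
      using that by (intro E_I v(3) subsetD[OF v(2)]) auto
    have "part ns i \<subseteq> ?V" using part_V i(1) by blast
    then have "ideal_height (poly_ring (bei_vars n))
        (binomial_edge_ideal n ?E :: (nat \<times> nat, 'k) mpol set) \<le> enat (2 * (n - card (part ns i)))"
      by (rule ideal_height_vertex_cover[OF E_sub]) (use E_ne c_eq i(1) in metis)
    moreover have "ideal_height (poly_ring (bei_vars n))
        (binomial_edge_ideal n ?E :: (nat \<times> nat, 'k) mpol set) \<le> enat (n - 1)"
      by (rule ideal_height_vertices[OF E_sub n])
    ultimately show "ideal_height (poly_ring (bei_vars n))
        (binomial_edge_ideal n ?E :: (nat \<times> nat, 'k) mpol set) \<le> enat h"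
      using i(1) by (simp add: h_def card_part min_def)
  qed
qed

end
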